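(* Let $1\le k\le n-2$, let $R>0$ and let $f(x)=|x|^{-k}$. Every $k$-dimensional minimal submanifold $M$ of the sphere $S^{n-1}(R)=\{x\in\mathbb{R}^n: |x|=R\}$, regarded as a submanifold of $\mathbb{R}^n$, is $f$-unstable, i.e. not $f$-stable.
   Context: For a $k$-dimensional submanifold $M\subset\mathbb{R}^n$ put $\mathcal{E}_f(M)=\int_M f\,d\mathcal{H}_k$, where $\mathcal{H}_k$ is $k$-dimensional Hausdorff measure. Let $D$ be the flat connection of $\mathbb{R}^n$ (and $Df$, $\mathrm{Hess} f$ the Euclidean gradient and Hessian of $f$), let $(\cdot)^\perp$ be the projection to the normal space of $M$ in $\mathbb{R}^n$, let $\mathbf{B}(X,Y)=(D_XY)^\perp$ be the second fundamental form, let $e_1,\dots,e_k$ be a local orthonormal tangent frame of $M$, and let $\mathbf{H}=\sum_{i=1}^k\mathbf{B}(e_i,e_i)$. Let $M$ be a $k$-dimensional $C^2$ submanifold embedded in $\mathbb{R}^n$, with closure $\bar M$, and let $U\subset\mathbb{R}^n$ be open with $U\cap M\neq\varnothing$ and $U\cap(\bar M\setminus M)=\varnothing$. $M$ is $f$-stationary in $U$ if the first variation of $\mathcal{E}_f$ vanishes for all deformations of $M$ compactly supported in $U$, equivalently if $f\mathbf{H}=(Df)^\perp$. (Minimal $k$-dimensional submanifolds of $S^{n-1}(R)$ satisfy this equation for $f=|x|^{-k}$.) An $f$-stationary $M$ is $f$-stable in $U$ if for every normal variation field $X$ along $M$ (normal to $M$ in $\mathbb{R}^n$) with compact support in $U$,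 $$\int_M f\Big[\sum_{i,j=1}^k\langle\mathbf{B}(e_i,e_j),X\rangle^2+\langle\mathbf{H},X\rangle^2\Big]d\mathcal{H}_k\le\int_M \Big(f\sum_{i=1}^k|(D_{e_i}X)^\perp|^2+\mathrm{Hess} f(X,X)\Big)d\mathcal{H}_k .$$ Here stability is considered in $U=\mathbb{R}^n\setminus\{0\}$, where $f=|x|^{-k}$ is smooth. *)

theory Defs
  imports "HOL-Analysis.Analysis"
begin

section \<open>Hausdorff measure\<close>

text \<open>
  The guard for empty sets only matters for \<open>k = 0\<close>, where \<open>0 ^ 0 = 1\<close>.
  Boundedness is required explicitly because \<^const>\<open>diameter\<close> is a real number,
  hence meaningless on unbounded sets.
\<close>

definition hausdorff_pre :: "nat \<Rightarrow> real \<Rightarrow> 'a::euclidean_space set \<Rightarrow> ennreal" where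
  "hausdorff_pre k \<delta> A =
     (INF C \<in> {C :: nat \<Rightarrow> 'a set. A \<subseteq> (\<Union>i. C i) \<and> (\<forall>i. bounded (C i) \<and> diameter (C i) \<le> \<delta>)}.
        (\<Sum>i. if C i = {} then 0
             else ennreal (unit_ball_vol (real k) * (diameter (C i) / 2) ^ k)))"

definition hausdorff_outer :: "nat \<Rightarrow> 'a::euclidean_space set \<Rightarrow> ennreal" where
  "hausdorff_outer k A = (SUP \<delta> \<in> {0<..}. hausdorff_pre k \<delta> A)"

text \<open>
  \<^const>\<open>hausdorff_outer\<close> is a metric outer measure, hence countably additive on the
  Borel sets; so \<^const>\<open>measure_of\<close> returns its restriction to the Borel sets.
\<close>

definition hausdorff :: "nat \<Rightarrow> 'a::euclidean_space measure" where
  "hausdorff k = measure_of UNIV (sets borel) (hausdorff_outer k)"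


section \<open>Submanifolds of Euclidean space\<close>

definition C1_on :: "('a::real_normed_vector \<Rightarrow> 'b::real_normed_vector) \<Rightarrow> 'a set \<Rightarrow> bool" where
  "C1_on F W \<longleftrightarrow>
     (\<exists>F' :: 'a \<Rightarrow> 'a \<Rightarrow>\<^sub>L 'b.
        (\<forall>x\<in>W. (F has_derivative blinfun_apply (F' x)) (at x)) \<and> continuous_on W F')"

definition C2_on :: "('a::real_normed_vector \<Rightarrow> 'b::real_normed_vector) \<Rightarrow> 'a set \<Rightarrow> bool" where
  "C2_on F W \<longleftrightarrow>
     (\<exists>F' :: 'a \<Rightarrow> 'a \<Rightarrow>\<^sub>L 'b.
        (\<forall>x\<in>W. (F has_derivative blinfun_apply (F' x)) (at x)) \<and> C1_on F' W)"

definition C2_submanifold :: "nat \<Rightarrow> 'a::euclidean_space set \<Rightarrow> bool" where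
  "C2_submanifold k M \<longleftrightarrow>
     (\<forall>p\<in>M. \<exists>W V \<phi> \<psi> S.
        open W \<and> p \<in> W \<and> open (V :: 'a set) \<and> homeomorphism W V \<phi> \<psi> \<and>
        C2_on \<phi> W \<and> C2_on \<psi> V \<and>
        subspace S \<and> dim S = k \<and> \<phi> ` (M \<inter> W) = S \<inter> V)"

definition tangent_space :: "'a::euclidean_space set \<Rightarrow> 'a \<Rightarrow> 'a set" where
  "tangent_space M p =
     {v. \<exists>(\<gamma> :: real \<Rightarrow> 'a) \<epsilon>. \<epsilon> > 0 \<and> C1_on \<gamma> {-\<epsilon><..<\<epsilon>} \<and> \<gamma> ` {-\<epsilon><..<\<epsilon>} \<subseteq> M \<and>
          \<gamma> 0 = p \<and> (\<gamma> has_vector_derivative v) (at 0)}"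

text \<open>
  The normal space of \<open>M\<close> inside an ambient submanifold \<open>N\<close>; the normal space
  in Euclidean space is the case \<open>N = UNIV\<close>.
\<close>

definition normal_space :: "'a::euclidean_space set \<Rightarrow> 'a set \<Rightarrow> 'a \<Rightarrow> 'a set" where
  "normal_space N M p = {v \<in> tangent_space N p. \<forall>w\<in>tangent_space M p. orthogonal v w}"

definition orth_proj :: "'a::euclidean_space set \<Rightarrow> 'a \<Rightarrow> 'a" where
  "orth_proj S x = (THE y. y \<in> S \<and> (\<forall>z\<in>S. orthogonal (x - y) z))"

definition orthonormal_frame :: "'a::euclidean_space set \<Rightarrow> 'a \<Rightarrow> 'a set" where
  "orthonormal_frame M p =
     (SOME E. E \<subseteq> tangent_space M p \<and> pairwise orthogonal E \<and> (\<forall>e\<in>E. norm e = 1) \<and>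
              span E = tangent_space M p)"


section \<open>Fields along a submanifold and curvature\<close>

definition C1_along :: "'a::euclidean_space set \<Rightarrow> ('a \<Rightarrow> 'a) \<Rightarrow> bool" where
  "C1_along M X \<longleftrightarrow>
     (\<forall>p\<in>M. \<exists>W Y. open W \<and> p \<in> W \<and> C1_on Y W \<and> (\<forall>x\<in>M \<inter> W. Y x = X x))"

text \<open>
  \<open>D_along M X p u\<close> is the flat derivative \<open>D\<^sub>u X\<close> at \<open>p\<close> of a field \<open>X\<close> along \<open>M\<close>, for \<open>u\<close>
  tangent to \<open>M\<close>. A derivative within \<open>M\<close> is determined only on the tangent space, but there
  it is unique.
\<close>

definition D_along :: "'a::euclidean_space set \<Rightarrow> ('a \<Rightarrow> 'a) \<Rightarrow> 'a \<Rightarrow> 'a \<Rightarrow> 'a" where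
  "D_along M X p u = (THE w. \<exists>X'. (X has_derivative X') (at p within M) \<and> w = X' u)"

text \<open>
  The second fundamental form of \<open>M\<close> in \<open>N\<close>, where \<open>N\<close> carries the metric induced from
  Euclidean space: its Levi-Civita connection is the tangential part of \<open>D\<close>, so
  \<open>\<nabla>\<^sub>u Y\<close> and \<open>D\<^sub>u Y\<close> have the same projection to the normal space of \<open>M\<close> in \<open>N\<close>.
  The value does not depend on the local tangent field \<open>Y\<close> that extends \<open>v\<close>.
\<close>

definition second_fundamental_form ::
    "'a::euclidean_space set \<Rightarrow> 'a set \<Rightarrow> 'a \<Rightarrow> 'a \<Rightarrow> 'a \<Rightarrow> 'a" where
  "second_fundamental_form N M p u v =
     (THE w. \<exists>W Y. open W \<and> p \<in> W \<and> C1_along (M \<inter> W) Y \<and>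
                   (\<forall>x\<in>M \<inter> W. Y x \<in> tangent_space M x) \<and> Y p = v \<and>
                   w = orth_proj (normal_space N M p) (D_along M Y p u))"

definition mean_curvature :: "'a::euclidean_space set \<Rightarrow> 'a set \<Rightarrow> 'a \<Rightarrow> 'a" where
  "mean_curvature N M p = (\<Sum>e\<in>orthonormal_frame M p. second_fundamental_form N M p e e)"

definition minimal_submanifold :: "nat \<Rightarrow> 'a::euclidean_space set \<Rightarrow> 'a set \<Rightarrow> bool" where
  "minimal_submanifold k N M \<longleftrightarrow>
     C2_submanifold k M \<and> M \<subseteq> N \<and> (\<forall>p\<in>M. mean_curvature N M p = 0)"


section \<open>Stationarity and stability\<close>

definition grad :: "('a::euclidean_space \<Rightarrow> real) \<Rightarrow> 'a \<Rightarrow> 'a" where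
  "grad f x = (THE g. GDERIV f x :> g)"

definition hess :: "('a::euclidean_space \<Rightarrow> real) \<Rightarrow> 'a \<Rightarrow> 'a \<Rightarrow> 'a \<Rightarrow> real" where
  "hess f x u v = frechet_derivative (grad f) (at x) u \<bullet> v"

definition f_stationary ::
    "('a::euclidean_space \<Rightarrow> real) \<Rightarrow> 'a set \<Rightarrow> 'a set \<Rightarrow> bool" where
  "f_stationary f U M \<longleftrightarrow>
     (\<forall>p\<in>M \<inter> U. f p *\<^sub>R mean_curvature UNIV M p = orth_proj (normal_space UNIV M p) (grad f p))"

text \<open>
  Normal fields of a \<open>C\<^sup>2\<close> submanifold are in general no better than \<open>C\<^sup>1\<close>, which is the
  regularity of the variation fields here.
\<close>

definition normal_variation :: "'a::euclidean_space set \<Rightarrow> 'a set \<Rightarrow> ('a \<Rightarrow> 'a) \<Rightarrow> bool" where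
  "normal_variation U M X \<longleftrightarrow>
     C1_along M X \<and> (\<forall>p\<in>M. X p \<in> normal_space UNIV M p) \<and>
     compact (closure {p \<in> M. X p \<noteq> 0}) \<and> closure {p \<in> M. X p \<noteq> 0} \<subseteq> U"

definition f_stable ::
    "nat \<Rightarrow> ('a::euclidean_space \<Rightarrow> real) \<Rightarrow> 'a set \<Rightarrow> 'a set \<Rightarrow> bool" where
  "f_stable k f U M \<longleftrightarrow>
     f_stationary f U M \<and>
     (\<forall>X. normal_variation U M X \<longrightarrow>
        (LINT p:M|hausdorff k.
           f p * ((\<Sum>u\<in>orthonormal_frame M p. \<Sum>v\<in>orthonormal_frame M p.
                     (second_fundamental_form UNIV M p u v \<bullet> X p)\<^sup>2)
                  + (mean_curvature UNIV M p \<bullet> X p)\<^sup>2))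
        \<le> (LINT p:M|hausdorff k.
             f p * (\<Sum>u\<in>orthonormal_frame M p.
                      (norm (orth_proj (normal_space UNIV M p) (D_along M X p u)))\<^sup>2)
             + hess f p (X p) (X p)))"

end

theory Submission
  imports Defs
begin

text \<open>
  Simons' averaging argument. For a constant vector \<open>v\<close>, take as variation field \<open>X v\<close> the part of
  \<open>v\<close> that is tangent to the sphere and normal to \<open>M\<close>. Its normal derivative in a tangent direction
  \<open>u\<close> is, up to sign, the second fundamental form of \<open>M\<close> in the sphere at \<open>u\<close> and the tangential
  part of \<open>v\<close>; \<open>X v\<close> is orthogonal to the mean curvature vector, which is radial. When the
  stability inequalities are summed over an orthonormal basis of vectors \<open>v\<close>, the curvature and the
  gradient terms both give the squared norm of that second fundamental form and cancel. What remains is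
  the Hessian term, the integral of \<open>- k (n - 1 - k) R powi (- k - 2)\<close> over \<open>M\<close>, which is negative as
  soon as \<open>M\<close> has positive and finite Hausdorff measure. Here \<open>M\<close> is closed in the sphere, hence compact.

  With the given definitions a non-measurable or non-integrable integrand would make both
  integrals vanish, so the integrands must be shown to be continuous on \<open>M\<close>; and \<open>hausdorff k\<close> would
  be the zero measure if the outer measure were not countably additive on the Borel sets.
\<close>

section \<open>Metric outer measures\<close>

text \<open>The whole geometry of \<open>M\<close> is read off one map, the projection
  \<open>P p\<close> onto the tangent space, and its derivative \<open>dproj\<close> along
  \<open>M\<close>. It is C1 because charts are C2, and it avoids local frames, which
  \<open>orthonormal_frame\<close> cannot supply continuously, being chosen point by point.
  Differentiating \<open>P x (P x v) = P x v\<close> shows that \<open>dproj\<close> sends tangent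
  vectors to normal ones; differentiating \<open>P x v \<bullet> x = 0\<close> gives their radial
  part. The cancellation is an exchange of indices. The curvature term of \<open>X v\<close> is a
  sum over \<open>d\<close> of squared pairings of \<open>dproj\<close> at \<open>d\<close> with
  \<open>X v\<close>, the gradient term the same with \<open>d\<close> and \<open>v\<close>
  exchanged. The exchange comes from the self-adjointness of the projection onto the normal space in
  the sphere. The constant has two sources: the Hessian of \<open>f\<close> on vectors orthogonal to
  \<open>x\<close> is \<open>- k\<close> times \<open>norm x powi (- k - 2)\<close> times the
  squared norm, and the squared norms of the \<open>X v\<close> add up to the trace of that
  projection, \<open>n - 1 - k\<close>. Compactness gives finite measure and also makes the
  \<open>X v\<close> admissible variations without any cutoff.\<close>

locale metric_outer_measure =
  fixes \<mu> :: "'a::metric_space set \<Rightarrow> ennreal"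
  assumes outer_empty: "\<mu> {} = 0"
    and mono: "A \<subseteq> B \<Longrightarrow> \<mu> A \<le> \<mu> B"
    and subadd: "\<mu> (\<Union>i::nat. C i) \<le> (\<Sum>i. \<mu> (C i))"
    and add: "0 < d \<Longrightarrow> (\<And>a b. a \<in> A \<Longrightarrow> b \<in> B \<Longrightarrow> d \<le> dist a b) \<Longrightarrow> \<mu> A + \<mu> B \<le> \<mu> (A \<union> B)"

lemma (in metric_outer_measure) Un_le: "\<mu> (A \<union> B) \<le> \<mu> A + \<mu> B"
  using subadd[of "binaryset A B"] suminf_binaryset_eq[of \<mu> A B, OF outer_empty]
  by (simp add: UN_binaryset_eq)

text \<open>Induction on \<open>n\<close>: each new set only has to keep a positive distance, which
  may depend on \<open>n\<close>, from the union of the earlier ones.\<close>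

lemma (in metric_outer_measure) separated_union:
  fixes S :: "nat \<Rightarrow> 'a set"
  assumes sep: "\<And>n. \<exists>d>0. \<forall>a\<in>(\<Union>m<n. S m). \<forall>b\<in>S n. d \<le> dist a b"
  shows "(\<Sum>m<n. \<mu> (S m)) \<le> \<mu> (\<Union>m<n. S m)"
proof (induction n)
  case 0
  then show ?case by (simp add: outer_empty)
next
  case (Suc n)
  obtain d where d: "d > 0" "\<forall>a\<in>(\<Union>m<n. S m). \<forall>b\<in>S n. d \<le> dist a b" using sep by blast
  have "(\<Sum>m<Suc n. \<mu> (S m)) \<le> \<mu> (\<Union>m<n. S m) + \<mu> (S n)"
    using Suc by (simp add: add_right_mono)
  also have "\<dots> \<le> \<mu> ((\<Union>m<n. S m) \<union> S n)"
    using d by (intro add) auto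
  also have "(\<Union>m<n. S m) \<union> S n = (\<Union>m<Suc n. S m)" by (auto simp: less_Suc_eq)
  finally show ?case .
qed

lemma ennreal_suminf_tail_less:
  fixes d :: "nat \<Rightarrow> ennreal" and e :: ennreal
  assumes fin: "(\<Sum>m. d m) < top" and e: "0 < e"
  obtains n where "(\<Sum>j. d (j + n)) < e"
proof (cases "(\<Sum>m. d m) = 0")
  case True
  then have "(\<Sum>j. d (j + 0)) < e" using e by simp
  then show ?thesis by (rule that)
next
  case False
  have lim: "(\<lambda>n. \<Sum>m<n. d m) \<longlonglongrightarrow> (\<Sum>m. d m)"
    by (intro summable_LIMSEQ) simp
  define T where "T = (\<Sum>m. d m)"
  \<comment> \<open>Strictness needs \<open>T\<close> positive, which is why a zero total was split
    off.\<close>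
  have "T - e < T"
    using fin e False unfolding T_def by (intro ennreal_between) (auto simp: zero_less_iff_neq_zero)
  then have "\<forall>\<^sub>F n in sequentially. T - e < (\<Sum>m<n. d m)"
    using lim order_tendstoD(1) unfolding T_def by blast
  then obtain n where n: "T - e < (\<Sum>m<n. d m)" by (auto simp: eventually_sequentially)
  have "T = (\<Sum>j. d (j + n)) + (\<Sum>m<n. d m)"
    unfolding T_def by (rule suminf_offset) simp
  moreover have "T < U + e" if "T - e < U" for U
  proof (rule ccontr)
    assume "\<not> T < U + e"
    then have "U \<le> T - e"
      using fin unfolding T_def[symmetric]
      by (cases T; cases U; cases e) (auto simp: ennreal_minus ennreal_less_iff simp flip: ennreal_plus intro!: ennreal_leI)
    then show False using that by simp
  qed
  note this[OF n]
  ultimately have "(\<Sum>m<n. d m) + (\<Sum>j. d (j + n)) < (\<Sum>m<n. d m) + e" by (simp add: add.commute)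
  then have "(\<Sum>j. d (j + n)) < e" by (simp add: ennreal_add_left_cancel_less)
  then show ?thesis by (rule that)
qed

text \<open>Caratheodory's criterion. \<open>A - F\<close> may come arbitrarily close to
  \<open>F\<close>, so \<open>add\<close> applies only to the part \<open>K n\<close> at distance at
  least \<open>r n\<close>. What is missing from \<open>K n\<close> is covered by the shells
  \<open>D m\<close> with \<open>m \<ge> n\<close>; the measures of all shells have a finite sum, so
  this tail is negligible.\<close>

lemma (in metric_outer_measure) closed_split:
  assumes F: "closed F"
  shows "\<mu> (A \<inter> F) + \<mu> (A - F) \<le> \<mu> A"
\<comment> \<open>\<open>infdist\<close> to the empty set is 0 by convention, so the shells would
  not make sense there.\<close>
proof (cases "F = {} \<or> \<mu> A = top")
  case True
  then show ?thesis using outer_empty by auto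
next
  case False
  then have Fne: "F \<noteq> {}" and Afin: "\<mu> A < top" by (auto simp: less_top)
  define r where "r n = 1 / (real n + 1)" for n
  have r_pos: "r n > 0" for n by (simp add: r_def)
  have r_dec: "r n < r m" if "m < n" for m n using that by (simp add: r_def frac_less2)
  define K where "K n = {x \<in> A. r n \<le> infdist x F}" for n
  define D where "D n = {x \<in> A. r (Suc n) \<le> infdist x F \<and> infdist x F < r n}" for n
  have K_bd: "\<mu> (A \<inter> F) + \<mu> (K n) \<le> \<mu> A" for n
  proof -
    have "\<mu> (A \<inter> F) + \<mu> (K n) \<le> \<mu> ((A \<inter> F) \<union> K n)"
    proof (rule add[OF r_pos])
      fix a b assume "a \<in> A \<inter> F" "b \<in> K n"
      then show "r n \<le> dist a b"
        unfolding K_def by (metis (no_types, lifting) IntE dist_commute infdist_le mem_Collect_eq order_trans)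
    qed
    also have "\<dots> \<le> \<mu> A" by (rule mono) (auto simp: K_def)
    finally show ?thesis .
  qed
  \<comment> \<open>Neighbouring shells may touch, but shells of equal parity are kept apart by the
    width of the omitted shell \<open>D (2 * n + i - 1)\<close>. Hence the even and the odd shells
    are summed separately.\<close>
  have D_sep: "\<exists>d>0. \<forall>a\<in>(\<Union>m<n. D (2 * m + i)). \<forall>b\<in>D (2 * n + i). d \<le> dist a b" for n i
  proof (cases n)
    case 0
    then show ?thesis by (auto intro!: exI[of _ 1])
  next
    case (Suc n')
    have "r (2 * n + i - 1) - r (2 * n + i) \<le> dist a b"
      if a: "a \<in> D (2 * m + i)" and m: "m < n" and b: "b \<in> D (2 * n + i)" for a b m
    proof -
      have "Suc (2 * m + i) \<le> 2 * n + i - 1" using m by linarith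
      then have "r (2 * n + i - 1) \<le> r (Suc (2 * m + i))"
        using r_dec by (metis le_less)
      also have "\<dots> \<le> infdist a F" using a by (simp add: D_def)
      also have "\<dots> \<le> infdist b F + dist a b" by (rule infdist_triangle)
      also have "infdist b F < r (2 * n + i)" using b by (simp add: D_def)
      finally show ?thesis by simp
    qed
    moreover have "r (2 * n + i - 1) - r (2 * n + i) > 0" using r_dec Suc by simp
    ultimately show ?thesis by blast
  qed
  have half: "(\<Sum>m. \<mu> (D (2 * m + i))) \<le> \<mu> A" for i
  proof (rule suminf_le_const)
    fix n
    have "(\<Sum>m<n. \<mu> (D (2 * m + i))) \<le> \<mu> (\<Union>m<n. D (2 * m + i))"
      by (rule separated_union[OF D_sep])
    also have "\<dots> \<le> \<mu> A" by (rule mono) (auto simp: D_def)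
    finally show "(\<Sum>m<n. \<mu> (D (2 * m + i))) \<le> \<mu> A" .
  qed simp
  have "(\<Sum>m. \<mu> (D m)) \<le> \<mu> A + \<mu> A"
  proof (rule suminf_le_const)
    fix n
    have "(\<Sum>m<n. \<mu> (D m)) \<le> (\<Sum>m<2*n. \<mu> (D m))" by (rule sum_mono2) auto
    also have "\<dots> = (\<Sum>m<n. \<mu> (D (2 * m + 0))) + (\<Sum>m<n. \<mu> (D (2 * m + 1)))"
      by (induction n) (simp_all add: ac_simps)
    also have "\<dots> \<le> (\<Sum>m. \<mu> (D (2 * m + 0))) + (\<Sum>m. \<mu> (D (2 * m + 1)))"
      by (intro add_mono sum_le_suminf) auto
    also have "\<dots> \<le> \<mu> A + \<mu> A" by (intro add_mono half)
    finally show "(\<Sum>m<n. \<mu> (D m)) \<le> \<mu> A + \<mu> A" .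
  qed simp
  then have Dfin: "(\<Sum>m. \<mu> (D m)) < top" using Afin
    by (meson ennreal_add_less_top le_less_trans)
  show ?thesis
  proof (rule ennreal_le_epsilon)
    fix e :: real assume "0 < e"
    then obtain n where n: "(\<Sum>j. \<mu> (D (j + n))) < ennreal e"
      using ennreal_suminf_tail_less[OF Dfin, of "ennreal e"] by auto
    define B where "B j = (case j of 0 \<Rightarrow> K n | Suc j \<Rightarrow> D (j + n))" for j
    have "A - F \<subseteq> (\<Union>j. B j)"
    proof
      fix x assume x: "x \<in> A - F"
      then have pos: "infdist x F > 0" using F Fne infdist_pos_not_in_closed by auto
      obtain N where "inverse (real (Suc N)) < infdist x F" using reals_Archimedean[OF pos] by auto
      then have ex: "r N \<le> infdist x F" by (simp add: r_def inverse_eq_divide add.commute)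
      show "x \<in> (\<Union>j. B j)"
      proof (cases "r n \<le> infdist x F")
        case True
        then have "x \<in> B 0" using x by (simp add: B_def K_def)
        then show ?thesis by blast
      next
        case False
        \<comment> \<open>The least radius index not exceeding the distance of \<open>x\<close>
          locates its shell, \<open>D (l - 1)\<close>.\<close>
        define l where "l = (LEAST l. r l \<le> infdist x F)"
        have l: "r l \<le> infdist x F" unfolding l_def by (rule LeastI[of "\<lambda>l. r l \<le> infdist x F", OF ex])
        have ln: "n < l"
        proof (rule ccontr)
          assume "\<not> n < l"
          then have "r n \<le> r l" using r_dec[of l n] by (cases "l = n") auto
          then show False using l False by simp
        qed
        then obtain j where j: "l = Suc (j + n)"
          by (metis add.commute less_imp_Suc_add)
        have "infdist x F < r (j + n)"
        proof (rule ccontr)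
          assume "\<not> infdist x F < r (j + n)"
          then have "l \<le> j + n" unfolding l_def by (intro Least_le) simp
          then show False using j by simp
        qed
        then have "x \<in> B (Suc j)" using x l j by (simp add: B_def D_def)
        then show ?thesis by blast
      qed
    qed
    then have "\<mu> (A - F) \<le> \<mu> (\<Union>j. B j)" by (rule mono)
    also have "\<dots> \<le> (\<Sum>j. \<mu> (B j))" by (rule subadd)
    also have "\<dots> = (\<Sum>j. \<mu> (B (j + 1))) + (\<Sum>j<1. \<mu> (B j))" by (rule suminf_offset) simp
    also have "\<dots> = (\<Sum>j. \<mu> (D (j + n))) + \<mu> (K n)" by (simp add: B_def)
    also have "\<dots> \<le> ennreal e + \<mu> (K n)" using n by (intro add_right_mono) simp
    finally have "\<mu> (A \<inter> F) + \<mu> (A - F) \<le> \<mu> (A \<inter> F) + (ennreal e + \<mu> (K n))"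
      by (rule add_left_mono)
    also have "\<dots> = (\<mu> (A \<inter> F) + \<mu> (K n)) + ennreal e" by (simp add: ac_simps)
    finally have "\<mu> (A \<inter> F) + \<mu> (A - F) \<le> (\<mu> (A \<inter> F) + \<mu> (K n)) + ennreal e" .
    also have "\<dots> \<le> \<mu> A + ennreal e" by (intro add_right_mono K_bd)
    finally show "\<mu> (A \<inter> F) + \<mu> (A - F) \<le> \<mu> A + ennreal e" .
  qed
qed

text \<open>The Caratheodory-measurable sets form a sigma-algebra on which \<open>\<mu>\<close> is
  countably additive. By \<open>closed_split\<close> it contains the closed sets, and these generate
  the Borel sets.\<close>

lemma (in metric_outer_measure) measure_space_borel:
  shows "measure_space UNIV (sets borel) \<mu>"
proof -
  interpret sigma_algebra UNIV "Pow (UNIV :: 'a set)" by (rule sigma_algebra_Pow)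
  have oms: "outer_measure_space (Pow UNIV) \<mu>"
    using outer_empty mono subadd
    by (auto simp: outer_measure_space_def positive_def increasing_def countably_subadditive_def)
  define L where "L = lambda_system (UNIV :: 'a set) (Pow UNIV) \<mu>"
  have ms: "measure_space UNIV L \<mu>" unfolding L_def by (rule caratheodory_lemma[OF oms])
  then have sigL: "sigma_algebra UNIV L" by (simp add: measure_space_def)
  have "F \<in> L" if "closed F" for F
  proof -
    have "\<mu> (F \<inter> A) + \<mu> ((UNIV - F) \<inter> A) = \<mu> A" for A
    proof (rule antisym)
      have "(UNIV - F) \<inter> A = A - F" by auto
      then show "\<mu> (F \<inter> A) + \<mu> ((UNIV - F) \<inter> A) \<le> \<mu> A"
        using closed_split[OF that, of A]
        by (simp add: Int_commute)
      have "\<mu> ((F \<inter> A) \<union> ((UNIV - F) \<inter> A)) \<le> \<mu> (F \<inter> A) + \<mu> ((UNIV - F) \<inter> A)"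
        by (rule Un_le)
      moreover have "(F \<inter> A) \<union> ((UNIV - F) \<inter> A) = A" by auto
      ultimately show "\<mu> A \<le> \<mu> (F \<inter> A) + \<mu> ((UNIV - F) \<inter> A)" by simp
    qed
    then show ?thesis by (simp add: L_def lambda_system_def)
  qed
  then have "sigma_sets UNIV {F :: 'a set. closed F} \<subseteq> L"
    by (intro sigma_algebra.sigma_sets_subset[OF sigL]) auto
  then have "sets (borel :: 'a measure) \<subseteq> L" by (simp add: borel_eq_closed)
  moreover have "sigma_algebra UNIV (sets (borel :: 'a measure))"
    by (metis sets.sigma_algebra_axioms space_borel)
  ultimately show ?thesis using ms measure_down by blast
qed

section \<open>Hausdorff measure\<close>

definition cell_weight :: "nat \<Rightarrow> 'a::euclidean_space set \<Rightarrow> ennreal" where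
  "cell_weight k C = (if C = {} then 0 else ennreal (unit_ball_vol (real k) * (diameter C / 2) ^ k))"

definition covers :: "real \<Rightarrow> 'a::euclidean_space set \<Rightarrow> (nat \<Rightarrow> 'a set) set" where
  "covers \<delta> A = {C. A \<subseteq> (\<Union>i. C i) \<and> (\<forall>i. bounded (C i) \<and> diameter (C i) \<le> \<delta>)}"

lemma hausdorff_pre_eq: "hausdorff_pre k \<delta> A = (INF C\<in>covers \<delta> A. \<Sum>i. cell_weight k (C i))"
  by (simp add: hausdorff_pre_def covers_def cell_weight_def)

lemma hausdorff_pre_le: "C \<in> covers \<delta> A \<Longrightarrow> hausdorff_pre k \<delta> A \<le> (\<Sum>i. cell_weight k (C i))"
  unfolding hausdorff_pre_eq by (rule INF_lower)

lemma cell_weight_empty [simp]: "cell_weight k {} = 0"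
  by (simp add: cell_weight_def)

lemma hausdorff_pre_empty: "\<delta> > 0 \<Longrightarrow> hausdorff_pre k \<delta> {} = 0"
  using hausdorff_pre_le[of "\<lambda>_. {}" \<delta> "{}" k] by (simp add: covers_def)

lemma hausdorff_pre_mono: "A \<subseteq> B \<Longrightarrow> hausdorff_pre k \<delta> A \<le> hausdorff_pre k \<delta> B"
  unfolding hausdorff_pre_eq by (rule INF_superset_mono) (auto simp: covers_def)

lemma hausdorff_pre_antimono: "\<delta> \<le> \<epsilon> \<Longrightarrow> hausdorff_pre k \<epsilon> A \<le> hausdorff_pre k \<delta> A"
  unfolding hausdorff_pre_eq
proof (rule INF_superset_mono)
  assume "\<delta> \<le> \<epsilon>"
  then show "covers \<delta> A \<subseteq> covers \<epsilon> A"
    unfolding covers_def by clarsimp (meson order_trans)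
qed simp

text \<open>Nearly optimal covers of the \<open>A i\<close>, with errors
  \<open>e * (1/2) ^ Suc i\<close> adding up to \<open>e\<close>, are merged into one sequence
  through the pairing \<open>prod_decode\<close>.\<close>

lemma hausdorff_pre_subadd:
  "hausdorff_pre k \<delta> (\<Union>i::nat. A i) \<le> (\<Sum>i. hausdorff_pre k \<delta> (A i))"
proof (rule ennreal_le_epsilon)
  fix e :: real assume e: "0 < e" and fin: "(\<Sum>i. hausdorff_pre k \<delta> (A i)) < top"
  have "\<exists>C\<in>covers \<delta> (A i). (\<Sum>j. cell_weight k (C j)) \<le> hausdorff_pre k \<delta> (A i) + e * (1/2) ^ Suc i" for i
  proof -
    have "hausdorff_pre k \<delta> (A i) < top" by (rule ennreal_suminf_lessD[OF fin])
    then have "hausdorff_pre k \<delta> (A i) < hausdorff_pre k \<delta> (A i) + e * (1/2) ^ Suc i"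
      using e by (auto simp: less_top)
    then show ?thesis unfolding hausdorff_pre_eq[of k \<delta> "A i"]
      by (subst (asm) INF_less_iff) (auto intro: less_imp_le)
  qed
  then obtain B where B: "B i \<in> covers \<delta> (A i)"
    and Ble: "(\<Sum>j. cell_weight k (B i j)) \<le> hausdorff_pre k \<delta> (A i) + e * (1/2) ^ Suc i" for i
    by metis
  define C where "C = case_prod B \<circ> prod_decode"
  have "C \<in> covers \<delta> (\<Union>i. A i)"
    unfolding covers_def
  proof (intro CollectI conjI allI subsetI)
    fix x assume "x \<in> (\<Union>i. A i)"
    then obtain i j where "x \<in> B i j" using B unfolding covers_def by blast
    then have "x \<in> C (prod_encode (i, j))" by (simp add: C_def)
    then show "x \<in> (\<Union>i. C i)" by blast
  qed (use B in \<open>auto simp: covers_def C_def split_def\<close>)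
  then have "hausdorff_pre k \<delta> (\<Union>i. A i) \<le> (\<Sum>i. cell_weight k (C i))"
    by (rule hausdorff_pre_le)
  also have "\<dots> = (\<Sum>i. cell_weight k (case_prod B (prod_decode i)))" by (simp add: C_def)
  also have "\<dots> = (\<Sum>i. \<Sum>j. cell_weight k (B i j))"
    by (rule suminf_ennreal_2dimen[of _ "\<lambda>p. cell_weight k (case_prod B p)"]) simp
  also have "\<dots> \<le> (\<Sum>i. hausdorff_pre k \<delta> (A i) + e * (1/2) ^ Suc i)"
    by (intro suminf_le allI Ble) auto
  also have "\<dots> = (\<Sum>i. hausdorff_pre k \<delta> (A i)) + (\<Sum>n. ennreal e * ennreal ((1/2) ^ Suc n))"
    using e by (subst suminf_add[symmetric])
      (auto simp del: ennreal_suminf_cmult simp add: ennreal_mult[symmetric])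
  also have "\<dots> = (\<Sum>i. hausdorff_pre k \<delta> (A i)) + e"
    unfolding ennreal_suminf_cmult
    by (subst suminf_ennreal_eq[OF zero_le_power power_half_series]) auto
  finally show "hausdorff_pre k \<delta> (\<Union>i. A i) \<le> (\<Sum>i. hausdorff_pre k \<delta> (A i)) + e" .
qed

lemma hausdorff_pre_le_outer: "0 < \<delta> \<Longrightarrow> hausdorff_pre k \<delta> A \<le> hausdorff_outer k A"
  unfolding hausdorff_outer_def by (rule SUP_upper) simp

text \<open>A set of diameter at most \<open>\<delta> < d\<close> cannot meet both \<open>A\<close>
  and \<open>B\<close>, so every cover of the union splits into a cover of \<open>A\<close> and a
  disjointly indexed cover of \<open>B\<close>.\<close>

lemma hausdorff_pre_separated:
  assumes "\<delta> < d" and sep: "\<And>a b. a \<in> A \<Longrightarrow> b \<in> B \<Longrightarrow> d \<le> dist a b"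
  shows "hausdorff_pre k \<delta> A + hausdorff_pre k \<delta> B \<le> hausdorff_pre k \<delta> (A \<union> B)"
  unfolding hausdorff_pre_eq[of k \<delta> "A \<union> B"]
proof (rule INF_greatest)
  fix C assume C: "C \<in> covers \<delta> (A \<union> B)"
  define restr where "restr X i = (if C i \<inter> X = {} then {} else C i)" for X i
  \<comment> \<open>The sign of \<open>\<delta>\<close> is extracted from the cover: the empty cells
    put into \<open>restr\<close> have diameter 0 and must be admissible.\<close>
  have "0 \<le> diameter (C 0)" using C by (intro diameter_ge_0) (auto simp: covers_def)
  also have "\<dots> \<le> \<delta>" using C by (auto simp: covers_def)
  finally have "0 \<le> \<delta>" .
  then have "restr X \<in> covers \<delta> X" if X: "X \<subseteq> A \<union> B" for X
  proof -
    have "X \<subseteq> (\<Union>i. restr X i)"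
    proof
      fix x assume "x \<in> X"
      moreover then obtain i where "x \<in> C i" using C X unfolding covers_def by blast
      ultimately have "x \<in> restr X i" by (auto simp: restr_def)
      then show "x \<in> (\<Union>i. restr X i)" by blast
    qed
    then show ?thesis using C \<open>0 \<le> \<delta>\<close> by (auto simp: covers_def restr_def)
  qed
  then have "hausdorff_pre k \<delta> A + hausdorff_pre k \<delta> B
      \<le> (\<Sum>i. cell_weight k (restr A i)) + (\<Sum>i. cell_weight k (restr B i))"
    by (intro add_mono hausdorff_pre_le) auto
  also have "\<dots> = (\<Sum>i. cell_weight k (restr A i) + cell_weight k (restr B i))"
    by (rule suminf_add) auto
  also have "\<dots> \<le> (\<Sum>i. cell_weight k (C i))"
  proof (rule suminf_le)
    fix i
    have "C i \<inter> A = {} \<or> C i \<inter> B = {}"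
    proof (rule ccontr)
      assume "\<not> (C i \<inter> A = {} \<or> C i \<inter> B = {})"
      then obtain a b where ab: "a \<in> C i" "a \<in> A" "b \<in> C i" "b \<in> B" by blast
      have "d \<le> dist a b" using sep ab by blast
      also have "\<dots> \<le> diameter (C i)"
        using C ab by (intro diameter_bounded_bound) (auto simp: covers_def)
      also have "\<dots> \<le> \<delta>" using C by (auto simp: covers_def)
      finally show False using assms(1) by simp
    qed
    then show "cell_weight k (restr A i) + cell_weight k (restr B i) \<le> cell_weight k (C i)"
      by (auto simp: restr_def)
  qed auto
  finally show "hausdorff_pre k \<delta> A + hausdorff_pre k \<delta> B \<le> (\<Sum>i. cell_weight k (C i))" .
qed

interpretation hausdorff: metric_outer_measure "hausdorff_outer k"
proof
  show "hausdorff_outer k {} = 0"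
    by (simp add: hausdorff_outer_def hausdorff_pre_empty)
next
  fix A B :: "'a set" assume "A \<subseteq> B"
  then show "hausdorff_outer k A \<le> hausdorff_outer k B"
    unfolding hausdorff_outer_def by (intro SUP_mono) (auto intro: hausdorff_pre_mono)
next
  fix C :: "nat \<Rightarrow> 'a set"
  show "hausdorff_outer k (\<Union>i. C i) \<le> (\<Sum>i. hausdorff_outer k (C i))"
    unfolding hausdorff_outer_def[of k "\<Union>i. C i"]
  proof (rule SUP_least)
    fix \<delta> :: real assume "\<delta> \<in> {0<..}"
    then have "(\<Sum>i. hausdorff_pre k \<delta> (C i)) \<le> (\<Sum>i. hausdorff_outer k (C i))"
      by (intro suminf_le hausdorff_pre_le_outer) auto
    then show "hausdorff_pre k \<delta> (\<Union>i. C i) \<le> (\<Sum>i. hausdorff_outer k (C i))"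
      using hausdorff_pre_subadd order_trans by blast
  qed
next
  fix d :: real and A B :: "'a set"
  assume d: "0 < d" and sep: "\<And>a b. a \<in> A \<Longrightarrow> b \<in> B \<Longrightarrow> d \<le> dist a b"
  have "hausdorff_outer k A + hausdorff_outer k B
      = (SUP \<delta>\<in>{0<..}. hausdorff_pre k \<delta> A + hausdorff_pre k \<delta> B)"
    unfolding hausdorff_outer_def
  \<comment> \<open>Both pre-measures grow as the scale shrinks, so the smaller of two scales
    dominates both.\<close>
  proof (rule SUP_add_directed_ennreal[symmetric])
    fix i j :: real assume "i \<in> {0<..}" "j \<in> {0<..}"
    then show "\<exists>l\<in>{0<..}. hausdorff_pre k i A + hausdorff_pre k j B
        \<le> hausdorff_pre k l A + hausdorff_pre k l B"
      by (intro bexI[of _ "min i j"] add_mono hausdorff_pre_antimono) auto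
  qed
  also have "\<dots> \<le> hausdorff_outer k (A \<union> B)"
  proof (rule SUP_least)
    fix \<delta> :: real assume "\<delta> \<in> {0<..}"
    \<comment> \<open>Passing to a scale below the separation \<open>d\<close> only increases the
      left side and makes the pre-measures additive.\<close>
    define \<epsilon> where "\<epsilon> = min \<delta> (d / 2)"
    have \<epsilon>: "0 < \<epsilon>" "\<epsilon> < d" "\<epsilon> \<le> \<delta>" using d \<open>\<delta> \<in> {0<..}\<close> by (auto simp: \<epsilon>_def)
    have "hausdorff_pre k \<delta> A + hausdorff_pre k \<delta> B \<le> hausdorff_pre k \<epsilon> A + hausdorff_pre k \<epsilon> B"
      using \<epsilon> by (intro add_mono hausdorff_pre_antimono)
    also have "\<dots> \<le> hausdorff_pre k \<epsilon> (A \<union> B)"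
      using \<epsilon> sep by (intro hausdorff_pre_separated[where d=d])
    also have "\<dots> \<le> hausdorff_outer k (A \<union> B)" using \<epsilon> by (intro hausdorff_pre_le_outer)
    finally show "hausdorff_pre k \<delta> A + hausdorff_pre k \<delta> B \<le> hausdorff_outer k (A \<union> B)" .
  qed
  finally show "hausdorff_outer k A + hausdorff_outer k B \<le> hausdorff_outer k (A \<union> B)" .
qed

lemma sets_hausdorff [simp, measurable_cong]: "sets (hausdorff k) = sets borel"
  using sets.sigma_sets_eq[of borel] by (simp add: hausdorff_def sets_measure_of_conv)

lemma emeasure_hausdorff:
  assumes "A \<in> sets borel"
  shows "emeasure (hausdorff k) A = hausdorff_outer k A"
  using hausdorff.measure_space_borel[of k] assms
  by (intro emeasure_measure_of[OF hausdorff_def])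
     (auto simp: measure_space_def)

section \<open>Finite Hausdorff measure of Lipschitz images\<close>

lemma hausdorff_pre_finite_cover:
  assumes "finite I" and cov: "A \<subseteq> (\<Union>i\<in>I. C i)"
    and bd: "\<And>i. i \<in> I \<Longrightarrow> bounded (C i)" and diam: "\<And>i. i \<in> I \<Longrightarrow> diameter (C i) \<le> r"
    and r: "0 \<le> r" "r \<le> \<delta>"
  shows "hausdorff_pre k \<delta> A \<le> ennreal (real (card I) * (unit_ball_vol (real k) * (r / 2) ^ k))"
proof -
  obtain h where h: "bij_betw h {0..<card I} I"
    using ex_bij_betw_nat_finite[OF assms(1)] by blast
  define D where "D n = (if n < card I then C (h n) else {})" for n
  have hI: "h n \<in> I" if "n < card I" for n using h that by (auto simp: bij_betw_def)
  have "D \<in> covers \<delta> A"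
    unfolding covers_def
  proof (intro CollectI conjI allI subsetI)
    fix x assume "x \<in> A"
    then obtain i where i: "i \<in> I" "x \<in> C i" using cov by blast
    then obtain n where "n < card I" "h n = i"
      using h by (metis atLeastLessThan_iff bij_betw_iff_bijections)
    then have "x \<in> D n" using i by (simp add: D_def)
    then show "x \<in> (\<Union>n. D n)" by blast
  next
    fix n
    show "bounded (D n)" using bd hI by (simp add: D_def)
    show "diameter (D n) \<le> \<delta>" using order_trans[OF diam[OF hI, of n] r(2)] r by (simp add: D_def)
  qed
  then have "hausdorff_pre k \<delta> A \<le> (\<Sum>n. cell_weight k (D n))" by (rule hausdorff_pre_le)
  also have "\<dots> = (\<Sum>n<card I. cell_weight k (D n))"
    by (rule suminf_finite) (auto simp: D_def)
  also have "\<dots> \<le> (\<Sum>n<card I. ennreal (unit_ball_vol (real k) * (r / 2) ^ k))"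
  proof (rule sum_mono)
    fix n assume "n \<in> {..<card I}"
    then have n: "n < card I" by simp
    have "0 \<le> diameter (D n)" using bd hI n by (intro diameter_ge_0) (simp add: D_def)
    moreover have "diameter (D n) \<le> r" using diam[OF hI, of n] n by (simp add: D_def)
    ultimately show "cell_weight k (D n) \<le> ennreal (unit_ball_vol (real k) * (r / 2) ^ k)"
      by (auto simp: cell_weight_def intro!: ennreal_leI mult_left_mono power_mono)
  qed
  also have "\<dots> = ennreal (real (card I) * (unit_ball_vol (real k) * (r / 2) ^ k))"
    using r by (simp add: ennreal_mult ennreal_of_nat_eq_real_of_nat)
  finally show ?thesis .
qed

text \<open>A grid of mesh \<open>1 / N\<close> in the \<open>k\<close>-plane \<open>S\<close> has
  of the order of \<open>N ^ k\<close> cells meeting \<open>Q\<close>, and their images have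
  diameter of order \<open>1 / N\<close>. The powers of \<open>N\<close> cancel in the sum of the
  weights, so the bound is uniform in the scale.\<close>

lemma hausdorff_outer_lipschitz_image_finite:
  fixes g :: "'a::euclidean_space \<Rightarrow> 'b::euclidean_space"
  assumes S: "subspace S" "dim S = k" and Q: "Q \<subseteq> S" "bounded Q" and g: "L-lipschitz_on Q g"
  shows "hausdorff_outer k (g ` Q) < top"
proof -
  obtain E where E: "E \<subseteq> S" "pairwise orthogonal E" "\<And>x. x \<in> E \<Longrightarrow> norm x = 1"
    and ind: "independent E" and card: "card E = k" and span: "span E = S"
    using orthonormal_basis_subspace[OF S(1)] S(2) by metis
  have finE: "finite E" using ind by (rule independent_imp_finite)
  obtain m0 where m0: "\<And>x. x \<in> Q \<Longrightarrow> norm x \<le> m0" using Q(2) bounded_iff by metis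
  \<comment> \<open>Taken at least 1 so that \<open>2 * (m * N) + 1\<close> is at most
    \<open>3 * (m * N)\<close> below.\<close>
  define m where "m = nat \<lceil>max 1 m0\<rceil>"
  have m: "norm x \<le> real m" if "x \<in> Q" for x
    using m0[OF that] unfolding m_def by linarith
  have m1: "1 \<le> m" unfolding m_def by linarith
  have L0: "0 \<le> L" by (rule lipschitz_on_nonneg[OF g])
  \<comment> \<open>At most \<open>(3 * m * N) ^ k\<close> cells, each with image of diameter at
    most \<open>L * k / N\<close>: this is what remains after \<open>N\<close> cancels.\<close>
  define K where "K = unit_ball_vol (real k) * (3 * real m * (L * real k) / 2) ^ k"
  have "hausdorff_pre k \<delta> (g ` Q) \<le> ennreal K" if "\<delta> > 0" for \<delta>
  proof -
    obtain N0 :: nat where "L * real k / \<delta> < real N0" using reals_Archimedean2 by blast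
    define N where "N = max 1 N0"
    have N: "1 \<le> N" "L * real k / real N \<le> \<delta>"
    proof -
      have "L * real k < real N0 * \<delta>" using \<open>L * real k / \<delta> < real N0\<close> that by (simp add: field_simps)
      also have "\<dots> \<le> real N * \<delta>" using that by (simp add: N_def)
      finally show "L * real k / real N \<le> \<delta>" by (simp add: N_def field_simps)
    qed (simp add: N_def)
    \<comment> \<open>A cell is labelled by the integer parts of the coordinates, scaled by
      \<open>N\<close>, in the orthonormal basis \<open>E\<close>; on \<open>Q\<close> these lie
      between \<open>- m * N\<close> and \<open>m * N\<close>.\<close>
    define I where "I = E \<rightarrow>\<^sub>E {- int (m * N)..int (m * N)}"
    define C where "C c = {x \<in> Q. \<forall>e\<in>E. \<lfloor>real N * (x \<bullet> e)\<rfloor> = c e}" for c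
    have finI: "finite I" unfolding I_def using finE by (intro finite_PiE) auto
    have "nat (2 * int (m * N) + 1) = 2 * (m * N) + 1" by linarith
    then have cardI: "card I = (2 * (m * N) + 1) ^ k"
      unfolding I_def using finE card by (simp add: card_PiE del: of_nat_mult)
    have "hausdorff_pre k \<delta> (g ` Q)
        \<le> ennreal (real (card I) * (unit_ball_vol (real k) * (L * real k / real N / 2) ^ k))"
    proof (rule hausdorff_pre_finite_cover[OF finI, of _ "\<lambda>c. g ` C c"])
      show "g ` Q \<subseteq> (\<Union>c\<in>I. g ` C c)"
      proof
        fix y assume "y \<in> g ` Q"
        then obtain x where x: "x \<in> Q" "y = g x" by blast
        define c where "c = restrict (\<lambda>e. \<lfloor>real N * (x \<bullet> e)\<rfloor>) E"
        have "\<lfloor>real N * (x \<bullet> e)\<rfloor> \<in> {- int (m * N)..int (m * N)}" if "e \<in> E" for e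
        proof -
          have "\<bar>x \<bullet> e\<bar> \<le> norm x * norm e" by (rule Cauchy_Schwarz_ineq2)
          also have "\<dots> \<le> real m" using E(3)[OF that] m[OF x(1)] by simp
          finally have "\<bar>real N * (x \<bullet> e)\<bar> \<le> real N * real m"
            by (simp add: abs_mult mult_left_mono)
          then have "- real (m * N) \<le> real N * (x \<bullet> e)" "real N * (x \<bullet> e) \<le> real (m * N)"
            by (simp_all add: abs_le_iff mult.commute)
          then show ?thesis by (auto simp: le_floor_iff floor_le_iff)
        qed
        then have "c \<in> I" by (auto simp: c_def I_def)
        moreover have "x \<in> C c" using x by (simp add: C_def c_def)
        ultimately show "y \<in> (\<Union>c\<in>I. g ` C c)" using x by blast
      qed
      fix c
      have dist: "dist (g x) (g y) \<le> L * real k / real N" if "x \<in> C c" "y \<in> C c" for x y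
      proof -
        have "x - y \<in> span E" using that Q span S(1) by (auto simp: C_def intro: subspace_diff)
        then have "x - y = (\<Sum>e\<in>E. ((x - y) \<bullet> e) *\<^sub>R e)"
          using orthonormal_basis_expand E finE by metis
        then have "norm (x - y) \<le> (\<Sum>e\<in>E. norm (((x - y) \<bullet> e) *\<^sub>R e))"
          by (metis norm_sum)
        also have "\<dots> \<le> (\<Sum>e\<in>E. 1 / real N)"
        proof (rule sum_mono)
          fix e assume e: "e \<in> E"
          then have "\<lfloor>real N * (x \<bullet> e)\<rfloor> = \<lfloor>real N * (y \<bullet> e)\<rfloor>" using that by (simp add: C_def)
          then have "\<bar>real N * (x \<bullet> e) - real N * (y \<bullet> e)\<bar> \<le> 1" by linarith
          then have "real N * \<bar>(x - y) \<bullet> e\<bar> \<le> 1"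
            by (simp add: inner_diff_left right_diff_distrib[symmetric] abs_mult)
          then show "norm (((x - y) \<bullet> e) *\<^sub>R e) \<le> 1 / real N"
            using N(1) E(3)[OF e] by (simp add: field_simps)
        qed
        also have "\<dots> = real k / real N" by (simp add: card)
        finally have "dist x y \<le> real k / real N" by (simp add: dist_norm)
        moreover have "dist (g x) (g y) \<le> L * dist x y"
          using that by (intro lipschitz_onD[OF g]) (auto simp: C_def)
        ultimately show ?thesis using L0 mult_left_mono[of "dist x y" "real k / real N" L] by simp
      qed
      show "diameter (g ` C c) \<le> L * real k / real N"
        using L0 dist by (intro diameter_le) (auto simp: dist_norm)
      show "bounded (g ` C c)"
        unfolding bounded_two_points using dist by blast
      show "0 \<le> L * real k / real N" "L * real k / real N \<le> \<delta>" using L0 N by auto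
    qed
    also have "\<dots> \<le> ennreal K"
    proof (rule ennreal_leI)
      have "real (card I) = (2 * (real m * real N) + 1) ^ k" by (simp add: cardI add.commute)
      also have "\<dots> \<le> (3 * (real m * real N)) ^ k"
      proof (rule power_mono)
        have "1 * 1 \<le> real m * real N" using m1 N(1) by (intro mult_mono) auto
        then show "2 * (real m * real N) + 1 \<le> 3 * (real m * real N)" by linarith
      qed simp
      finally have "real (card I) * (unit_ball_vol (real k) * (L * real k / real N / 2) ^ k)
          \<le> (3 * (real m * real N)) ^ k * (unit_ball_vol (real k) * (L * real k / real N / 2) ^ k)"
        using L0 by (intro mult_right_mono) auto
      also have "\<dots> = unit_ball_vol (real k) * ((3 * (real m * real N)) ^ k * (L * real k / real N / 2) ^ k)"
        by (simp only: mult_ac)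
      also have "(3 * (real m * real N)) ^ k * (L * real k / real N / 2) ^ k
          = (3 * (real m * real N) * (L * real k / real N / 2)) ^ k"
        by (simp only: power_mult_distrib)
      also have "3 * (real m * real N) * (L * real k / real N / 2) = 3 * real m * (L * real k) / 2"
        using N(1) by simp
      finally show "real (card I) * (unit_ball_vol (real k) * (L * real k / real N / 2) ^ k) \<le> K"
        by (simp add: K_def)
    qed
    finally show ?thesis .
  qed
  then have "hausdorff_outer k (g ` Q) \<le> ennreal K"
    unfolding hausdorff_outer_def by (intro SUP_least) auto
  then show ?thesis by (rule le_less_trans) simp
qed

section \<open>Positive Hausdorff measure by comparison with Lebesgue measure\<close>

definition slab :: "'a::euclidean_space set \<Rightarrow> 'a \<Rightarrow> real \<Rightarrow> 'a set" where
  "slab d p r = cbox (\<Sum>b\<in>Basis. (if b \<in> d then p \<bullet> b - r else -1) *\<^sub>R b)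
                     (\<Sum>b\<in>Basis. (if b \<in> d then p \<bullet> b + r else 1) *\<^sub>R b)"

lemma mem_slab: "x \<in> slab d p r \<longleftrightarrow>
    (\<forall>b\<in>Basis. if b \<in> d then \<bar>x \<bullet> b - p \<bullet> b\<bar> \<le> r else \<bar>x \<bullet> b\<bar> \<le> 1)"
  by (auto simp: slab_def mem_box abs_le_iff split: if_splits)

lemma emeasure_slab:
  fixes p :: "'a::euclidean_space"
  assumes "0 \<le> r" "d \<subseteq> Basis" "card d = k"
  shows "emeasure lborel (slab d p r) = ennreal ((2 * r) ^ k * 2 ^ (DIM('a) - k))"
proof -
  have "emeasure lborel (slab d p r) = ennreal (\<Prod>b\<in>Basis. if b \<in> d then 2 * r else 2)"
    using assms unfolding slab_def emeasure_lborel_cbox_eq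
    by (auto simp: inner_diff_left intro!: prod.cong arg_cong[where f=ennreal])
  also have "(\<Prod>b\<in>Basis. if b \<in> d then 2 * r else 2) = (2 * r) ^ card d * 2 ^ card (Basis - d)"
    using assms(2) by (simp add: prod.If_cases Int_absorb1 Diff_eq[symmetric])
  also have "card (Basis - d) = DIM('a) - k"
    using assms by (simp add: card_Diff_subset finite_subset[OF _ finite_Basis])
  finally show ?thesis using assms(3) by simp
qed

text \<open>Volume comparison. A cover of \<open>E\<close> is carried by \<open>g\<close>, followed
  by an isometry of \<open>S\<close> onto a coordinate plane, to a cover of a
  \<open>k\<close>-dimensional ball. Extending everything by \<open>[-1, 1]\<close> in the remaining
  coordinates turns the \<open>k\<close>-dimensional volume into Lebesgue measure of the whole
  space, where subadditivity bounds the total weight of the cover from below.\<close>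

lemma hausdorff_outer_pos:
  fixes g :: "'a::euclidean_space \<Rightarrow> 'b::euclidean_space"
  assumes S: "subspace S" "dim S = k" and c: "c \<in> S" and s: "0 < s" and sub: "S \<inter> ball c s \<subseteq> g ` E"
    and g: "L-lipschitz_on E g"
  shows "0 < hausdorff_outer k E"
proof -
  have "k \<le> card (Basis :: 'b set)" using S(2) dim_subset_UNIV[of S] by simp
  then obtain d :: "'b set" where d: "d \<subseteq> Basis" "card d = k" by (meson obtain_subset_with_card_n)
  define Z where "Z = {x :: 'b. \<forall>i\<in>Basis. i \<notin> d \<longrightarrow> x \<bullet> i = 0}"
  have "subspace Z" "dim Z = k"
    using subspace_substandard[of "\<lambda>i. i \<notin> d"] dim_substandard[OF d(1)] d(2) by (auto simp: Z_def)
  then obtain f where f: "linear f" "f ` S = Z" "\<And>x. x \<in> S \<Longrightarrow> norm (f x) = norm x"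
    using isometries_subspaces[OF S(1) \<open>subspace Z\<close>] S(2) by metis
  \<comment> \<open>\<open>f\<close> preserves norms only on \<open>S\<close>, while
    \<open>g\<close> may take values outside \<open>S\<close>; an operator bound is used for the
    differences of those values.\<close>
  obtain K where K: "0 < K" "\<And>x. norm (f x) \<le> norm x * K"
    using bounded_linear.pos_bounded[OF linear_conv_bounded_linear[THEN iffD1, OF f(1)]] by blast
  define h where "h = f \<circ> g"
  \<comment> \<open>The summand 1 keeps \<open>M\<close>, and hence \<open>J\<close>, positive even
    if \<open>L\<close> is 0.\<close>
  define M where "M = K * L + 1"
  have L0: "0 \<le> L" by (rule lipschitz_on_nonneg[OF g])
  have M: "0 < M" using K(1) L0 by (simp add: M_def add_nonneg_pos)
  have h: "norm (h x - h y) \<le> M * dist x y" if "x \<in> E" "y \<in> E" for x y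
  proof -
    have "norm (h x - h y) \<le> norm (g x - g y) * K"
      using K(2)[of "g x - g y"] by (simp add: h_def linear_diff[OF f(1)])
    also have "\<dots> \<le> (L * dist x y) * K"
      using lipschitz_onD[OF g that] K(1) by (intro mult_right_mono) (auto simp: dist_norm)
    also have "\<dots> \<le> M * dist x y" by (simp add: M_def algebra_simps)
    finally show ?thesis .
  qed
  \<comment> \<open>In the plane, the box of half-width \<open>a\<close> lies in the ball of radius
    \<open>s\<close>, since the sum of \<open>k\<close> coordinate differences is at most
    \<open>k * a < s\<close>.\<close>
  define a where "a = s / (real k + 1)"
  have a: "0 < a" using s by (simp add: a_def)
  define V where "V = (2 * a) ^ k * 2 ^ (DIM('b) - k)"
  have V: "0 < V" using a by (simp add: V_def)
  \<comment> \<open>The ratio between the volume of a slab of half-width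
    \<open>M * diameter C\<close> and the weight of the cell \<open>C\<close>.\<close>
  define J where "J = (4 * M) ^ k / unit_ball_vol (real k) * 2 ^ (DIM('b) - k)"
  have J: "0 < J" using M by (simp add: J_def)
  \<comment> \<open>The scale 1 is arbitrary: the estimate holds for any cover by bounded
    sets.\<close>
  have "ennreal (V / J) \<le> hausdorff_pre k 1 E"
    unfolding hausdorff_pre_eq
  proof (rule INF_greatest)
    fix C assume C: "C \<in> covers 1 E"
    have bd: "bounded (C i)" for i using C by (auto simp: covers_def)
    define e where "e i = (SOME x. x \<in> C i \<inter> E)" for i
    have e: "e i \<in> C i \<inter> E" if "C i \<inter> E \<noteq> {}" for i
      unfolding e_def using that by (metis ex_in_conv someI_ex)
    define T where "T i = (if C i \<inter> E = {} then {} else slab d (h (e i)) (M * diameter (C i)))" for i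
    have "slab d (f c) a \<subseteq> (\<Union>i. T i)"
    proof
      fix x assume x: "x \<in> slab d (f c) a"
      \<comment> \<open>The projection of \<open>x\<close> to the coordinate plane \<open>Z\<close>.
        Membership of \<open>x\<close> in a slab is a condition on these coordinates alone, apart
        from the range \<open>[-1, 1]\<close> of the others.\<close>
      define z where "z = (\<Sum>b\<in>d. (x \<bullet> b) *\<^sub>R b)"
      have find: "finite d" using d(1) by (rule finite_subset) simp
      have zb: "z \<bullet> b = (if b \<in> d then x \<bullet> b else 0)" if "b \<in> Basis" for b
        unfolding z_def inner_sum_left using d(1) that find
        by (simp add: inner_Basis subset_iff if_distrib cong: if_cong sum.cong)
      then have "z \<in> Z" by (simp add: Z_def)
      then obtain y where y: "y \<in> S" "z = f y" using f(2) by blast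
      have "norm (y - c) = norm (z - f c)"
        using f(3)[of "y - c"] y c S(1) by (simp add: linear_diff[OF f(1)] subspace_diff)
      also have "\<dots> \<le> (\<Sum>b\<in>Basis. \<bar>(z - f c) \<bullet> b\<bar>)" by (rule norm_le_l1)
      also have "\<dots> = (\<Sum>b\<in>d. \<bar>(z - f c) \<bullet> b\<bar>)"
      proof (rule sum.mono_neutral_right)
        have "f c \<in> Z" using c f(2) by blast
        then show "\<forall>b\<in>Basis - d. \<bar>(z - f c) \<bullet> b\<bar> = 0" using \<open>z \<in> Z\<close> by (simp add: Z_def inner_diff_left)
      qed (use d in auto)
      also have "\<dots> \<le> (\<Sum>b\<in>d. a)"
        using x d(1) zb by (intro sum_mono) (auto simp: mem_slab inner_diff_left subset_iff split: if_splits)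
      also have "\<dots> = real k * a" by (simp add: d(2))
      also have "\<dots> < s" using s by (simp add: a_def field_simps)
      finally have "y \<in> S \<inter> ball c s" using y by (simp add: dist_norm norm_minus_commute)
      then obtain w where w: "w \<in> E" "y = g w" using sub by blast
      then obtain i where i: "w \<in> C i" using C by (auto simp: covers_def)
      then have ne: "C i \<inter> E \<noteq> {}" using w by blast
      have "\<bar>x \<bullet> b - h (e i) \<bullet> b\<bar> \<le> M * diameter (C i)" if b: "b \<in> d" for b
      proof -
        have "b \<in> Basis" using b d(1) by blast
        then have "\<bar>x \<bullet> b - h (e i) \<bullet> b\<bar> = \<bar>(h w - h (e i)) \<bullet> b\<bar>"
          using zb[of b] b y w by (simp add: h_def inner_diff_left)
        also have "\<dots> \<le> norm (h w - h (e i))" using \<open>b \<in> Basis\<close> by (rule Basis_le_norm)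
        also have "\<dots> \<le> M * dist w (e i)" using h w e[OF ne] by blast
        also have "\<dots> \<le> M * diameter (C i)"
          using M i e[OF ne] bd by (intro mult_left_mono diameter_bounded_bound) auto
        finally show ?thesis .
      qed
      then have "x \<in> T i" using ne x by (auto simp: T_def mem_slab)
      then show "x \<in> (\<Union>i. T i)" by blast
    qed
    then have "emeasure lborel (slab d (f c) a) \<le> emeasure lborel (\<Union>i. T i)"
      by (intro emeasure_mono) (auto simp: T_def slab_def)
    also have "\<dots> \<le> (\<Sum>i. emeasure lborel (T i))"
      by (intro emeasure_subadditive_countably) (auto simp: T_def slab_def)
    also have "\<dots> \<le> (\<Sum>i. ennreal J * cell_weight k (C i))"
    proof (rule suminf_le)
      fix i
      have diam: "0 \<le> diameter (C i)" by (rule diameter_ge_0[OF bd])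
      show "emeasure lborel (T i) \<le> ennreal J * cell_weight k (C i)"
      proof (cases "C i \<inter> E = {}")
        case False
        then have "emeasure lborel (T i) = ennreal ((2 * (M * diameter (C i))) ^ k * 2 ^ (DIM('b) - k))"
          using M diam d by (simp add: T_def emeasure_slab)
        also have "(2 * (M * diameter (C i))) ^ k * 2 ^ (DIM('b) - k)
            = J * (unit_ball_vol (real k) * (diameter (C i) / 2) ^ k)"
        proof -
          have "2 * (M * diameter (C i)) = (4 * M) * (diameter (C i) / 2)" by simp
          then have "(2 * (M * diameter (C i))) ^ k = (4 * M) ^ k * (diameter (C i) / 2) ^ k"
            by (metis power_mult_distrib)
          moreover have "unit_ball_vol (real k) \<noteq> 0" using unit_ball_vol_pos[of "real k"] by linarith
          ultimately show ?thesis by (simp add: J_def)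
        qed
        also have "ennreal \<dots> = ennreal J * cell_weight k (C i)"
          using False J diam by (auto simp: cell_weight_def ennreal_mult)
        finally show ?thesis by simp
      qed (simp add: T_def)
    qed auto
    also have "\<dots> = ennreal J * (\<Sum>i. cell_weight k (C i))" by simp
    finally have "ennreal V \<le> ennreal J * (\<Sum>i. cell_weight k (C i))"
      using a d by (simp add: emeasure_slab V_def)
    then show "ennreal (V / J) \<le> (\<Sum>i. cell_weight k (C i))"
      using J V by (cases "\<Sum>i. cell_weight k (C i)")
        (auto simp: ennreal_mult[symmetric] field_simps)
  qed
  also have "\<dots> \<le> hausdorff_outer k E" by (rule hausdorff_pre_le_outer) simp
  finally show ?thesis using V J by (simp add: less_le_trans[of 0 "ennreal (V / J)"])
qed

section \<open>Continuously differentiable maps\<close>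

lemma C1_on_blinfunI:
  assumes "\<And>x. x \<in> W \<Longrightarrow> (F has_derivative blinfun_apply (F' x)) (at x)" "continuous_on W F'"
  shows "C1_on F W"
  unfolding C1_on_def by (rule exI[of _ F']) (use assms in simp)

lemma C1_on_blinfunE:
  assumes "C1_on F W"
  obtains F' where "\<And>x. x \<in> W \<Longrightarrow> (F has_derivative blinfun_apply (F' x)) (at x)" "continuous_on W F'"
  using assms unfolding C1_on_def by auto

lemma C1_on_differentiable: "C1_on F W \<Longrightarrow> x \<in> W \<Longrightarrow> F differentiable (at x)"
  by (metis C1_on_blinfunE differentiable_def)

lemma C1_on_continuous: "C1_on F W \<Longrightarrow> continuous_on W F"
  by (intro continuous_at_imp_continuous_on ballI differentiable_imp_continuous_within C1_on_differentiable)

lemma C1_on_cong: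
  assumes "C1_on F W" "open W" "\<And>x. x \<in> W \<Longrightarrow> F x = G x"
  shows "C1_on G W"
proof -
  obtain F' where F': "\<And>x. x \<in> W \<Longrightarrow> (F has_derivative blinfun_apply (F' x)) (at x)" "continuous_on W F'"
    using C1_on_blinfunE[OF assms(1)] by blast
  show ?thesis
  proof (rule C1_on_blinfunI[OF _ F'(2)])
    show "(G has_derivative blinfun_apply (F' x)) (at x)" if "x \<in> W" for x
      by (rule has_derivative_transform_within_open[OF F'(1)[OF that] assms(2) that assms(3)])
  qed
qed

lemma C2_onE:
  assumes "C2_on F W"
  obtains F' where "\<And>x. x \<in> W \<Longrightarrow> (F has_derivative blinfun_apply (F' x)) (at x)" "C1_on F' W"
  using assms unfolding C2_on_def by auto

lemma C2_on_imp_C1_on: "C2_on F W \<Longrightarrow> C1_on F W"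
  by (elim C2_onE) (rule C1_on_blinfunI[OF _ C1_on_continuous])

lemma C1_on_bounded_linear: "bounded_linear F \<Longrightarrow> C1_on F W"
  unfolding C1_on_def
  by (rule exI[of _ "\<lambda>_. Blinfun F"])
    (simp add: bounded_linear_Blinfun_apply bounded_linear_imp_has_derivative)

lemma C1_on_const: "C1_on (\<lambda>_. c) W"
  unfolding C1_on_def by (rule exI[of _ "\<lambda>_. 0"]) (simp add: zero_blinfun.rep_eq)

lemma C1_on_compose:
  assumes G: "C1_on G V" and F: "C1_on F W" and sub: "F ` W \<subseteq> V"
  shows "C1_on (\<lambda>x. G (F x)) W"
proof -
  obtain F' where F': "\<And>x. x \<in> W \<Longrightarrow> (F has_derivative blinfun_apply (F' x)) (at x)" "continuous_on W F'"
    using C1_on_blinfunE[OF F] by blast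
  obtain G' where G': "\<And>x. x \<in> V \<Longrightarrow> (G has_derivative blinfun_apply (G' x)) (at x)" "continuous_on V G'"
    using C1_on_blinfunE[OF G] by blast
  have "((\<lambda>x. G (F x)) has_derivative blinfun_apply (G' (F x) o\<^sub>L F' x)) (at x)" if "x \<in> W" for x
  proof -
    have "((\<lambda>x. G (F x)) has_derivative (\<lambda>h. G' (F x) (F' x h))) (at x)"
      using has_derivative_compose[OF F'(1)[OF that] G'(1)] that sub by blast
    then show ?thesis by (simp add: blinfun_compose.rep_eq comp_def)
  qed
  moreover have "continuous_on W (\<lambda>x. G' (F x) o\<^sub>L F' x)"
    by (intro bounded_bilinear.continuous_on[OF bounded_bilinear_blinfun_compose] F'(2)
        continuous_on_compose2[OF G'(2) C1_on_continuous[OF F] sub])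
  ultimately show ?thesis by (rule C1_on_blinfunI)
qed

text \<open>On a finite-dimensional domain, continuity of the derivative in operator norm may be
  tested on each fixed vector.\<close>

lemma C1_onI:
  fixes F :: "'a::euclidean_space \<Rightarrow> 'b::real_normed_vector"
  assumes "\<And>x. x \<in> W \<Longrightarrow> (F has_derivative F' x) (at x)" "\<And>h. continuous_on W (\<lambda>x. F' x h)"
  shows "C1_on F W"
proof -
  have ap: "blinfun_apply (Blinfun (F' x)) = F' x" if "x \<in> W" for x
    using assms(1)[OF that] by (simp add: bounded_linear_Blinfun_apply has_derivative_bounded_linear)
  have "continuous_on W (\<lambda>x. Blinfun (F' x))"
    by (rule continuous_on_blinfun_componentwise) (simp add: ap assms(2) cong: continuous_on_cong)
  then show ?thesis
    by (rule C1_on_blinfunI[rotated]) (simp add: ap assms(1))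
qed

lemma C1_onE:
  assumes "C1_on F W"
  obtains F' where "\<And>x. x \<in> W \<Longrightarrow> (F has_derivative F' x) (at x)" "\<And>h. continuous_on W (\<lambda>x. F' x h)"
proof -
  obtain F' where F': "\<And>x. x \<in> W \<Longrightarrow> (F has_derivative blinfun_apply (F' x)) (at x)" "continuous_on W F'"
    using C1_on_blinfunE[OF assms] by blast
  show ?thesis
    by (rule that[of "\<lambda>x. blinfun_apply (F' x)"]) (use F' in \<open>auto intro!: bounded_bilinear.continuous_on[OF bounded_bilinear_blinfun_apply] continuous_on_const\<close>)
qed

lemma C1_on_bilinear:
  fixes F :: "'a::euclidean_space \<Rightarrow> 'b::real_normed_vector"
  assumes "bounded_bilinear bm" and F: "C1_on F W" and G: "C1_on G W"
  shows "C1_on (\<lambda>x. bm (F x) (G x)) W"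
proof -
  interpret bounded_bilinear bm by fact
  obtain F' where F': "\<And>x. x \<in> W \<Longrightarrow> (F has_derivative F' x) (at x)" "\<And>h. continuous_on W (\<lambda>x. F' x h)"
    using C1_onE[OF F] by blast
  obtain G' where G': "\<And>x. x \<in> W \<Longrightarrow> (G has_derivative G' x) (at x)" "\<And>h. continuous_on W (\<lambda>x. G' x h)"
    using C1_onE[OF G] by blast
  show ?thesis
  proof (rule C1_onI)
    show "((\<lambda>x. bm (F x) (G x)) has_derivative (\<lambda>h. bm (F x) (G' x h) + bm (F' x h) (G x))) (at x)"
      if "x \<in> W" for x
      by (rule FDERIV[OF F'(1)[OF that] G'(1)[OF that]])
    show "continuous_on W (\<lambda>x. bm (F x) (G' x h) + bm (F' x h) (G x))" for h
      by (intro continuous_on_add continuous_on C1_on_continuous[OF F] C1_on_continuous[OF G] F'(2) G'(2))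
  qed
qed

lemmas C1_on_inner = C1_on_bilinear[OF bounded_bilinear_inner]
lemmas C1_on_scaleR = C1_on_bilinear[OF bounded_bilinear_scaleR]

lemma C1_on_add:
  fixes F :: "'a::euclidean_space \<Rightarrow> 'b::real_normed_vector"
  assumes F: "C1_on F W" and G: "C1_on G W"
  shows "C1_on (\<lambda>x. F x + G x) W"
proof -
  obtain F' where F': "\<And>x. x \<in> W \<Longrightarrow> (F has_derivative F' x) (at x)" "\<And>h. continuous_on W (\<lambda>x. F' x h)"
    using C1_onE[OF F] by blast
  obtain G' where G': "\<And>x. x \<in> W \<Longrightarrow> (G has_derivative G' x) (at x)" "\<And>h. continuous_on W (\<lambda>x. G' x h)"
    using C1_onE[OF G] by blast
  show ?thesis
    by (rule C1_onI[where F'="\<lambda>x h. F' x h + G' x h"])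
      (intro has_derivative_add continuous_on_add F' G'; assumption)+
qed

lemma C1_on_uminus: "C1_on F W \<Longrightarrow> C1_on (\<lambda>x. - F x) W"
  using C1_on_compose[OF C1_on_bounded_linear[OF bounded_linear_minus[OF bounded_linear_ident]], of F W UNIV]
  by simp

lemma C1_on_diff:
  fixes F :: "'a::euclidean_space \<Rightarrow> 'b::real_normed_vector"
  shows "C1_on F W \<Longrightarrow> C1_on G W \<Longrightarrow> C1_on (\<lambda>x. F x - G x) W"
  using C1_on_add[OF _ C1_on_uminus, of F W G] by simp

lemma C1_on_sum:
  fixes F :: "'i \<Rightarrow> 'a::euclidean_space \<Rightarrow> 'b::real_normed_vector"
  assumes "\<And>i. i \<in> I \<Longrightarrow> C1_on (F i) W"
  shows "C1_on (\<lambda>x. \<Sum>i\<in>I. F i x) W"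
  using assms by (induction I rule: infinite_finite_induct) (auto intro: C1_on_const C1_on_add)

lemma C1_on_inverse: "C1_on (\<lambda>x::real. inverse x) (- {0})"
proof (rule C1_onI)
  show "((\<lambda>x. inverse x) has_derivative (\<lambda>h. - (inverse x * h * inverse x))) (at x)"
    if "x \<in> - {0}" for x :: real
    using that by (auto intro: has_derivative_inverse')
  show "continuous_on (- {0}) (\<lambda>x::real. - (inverse x * h * inverse x))" for h
    by (intro continuous_intros) auto
qed

lemma C1_on_divide:
  fixes f g :: "'a::euclidean_space \<Rightarrow> real"
  assumes "C1_on f W" "C1_on g W" "\<And>x. x \<in> W \<Longrightarrow> g x \<noteq> 0"
  shows "C1_on (\<lambda>x. f x / g x) W"
proof -
  have "C1_on (\<lambda>x. inverse (g x)) W"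
    by (rule C1_on_compose[OF C1_on_inverse assms(2)]) (use assms(3) in auto)
  then show ?thesis
    using C1_on_bilinear[OF bounded_bilinear_mult assms(1)] by (simp add: divide_inverse)
qed

text \<open>Near \<open>p\<close> the operator norm of the derivative exceeds its value at
  \<open>p\<close> by at most 1; the mean value inequality applies because balls are convex.\<close>

lemma C1_on_locally_lipschitz:
  assumes F: "C1_on F W" and W: "open W" "p \<in> W"
  obtains r L where "0 < r" "ball p r \<subseteq> W" "L-lipschitz_on (ball p r) F"
proof -
  obtain F' where F': "\<And>x. x \<in> W \<Longrightarrow> (F has_derivative blinfun_apply (F' x)) (at x)" "continuous_on W F'"
    using C1_on_blinfunE[OF F] by blast
  have "isCont F' p" using F'(2) W continuous_on_eq_continuous_at by blast
  then obtain d where d: "0 < d" "\<And>x. dist x p < d \<Longrightarrow> dist (F' x) (F' p) < 1"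
    unfolding continuous_at_eps_delta by (metis zero_less_one)
  obtain e where e: "0 < e" "ball p e \<subseteq> W" using W open_contains_ball by blast
  define r where "r = min d e"
  define L where "L = norm (F' p) + 1"
  have sub: "ball p r \<subseteq> W" using e(2) by (auto simp: r_def)
  have "L-lipschitz_on (ball p r) F"
  proof (rule bounded_derivative_imp_lipschitz[where f'="\<lambda>x. blinfun_apply (F' x)"])
    show "(F has_derivative blinfun_apply (F' x)) (at x within ball p r)" if "x \<in> ball p r" for x
      using F'(1) sub that has_derivative_at_withinI by blast
    show "onorm (blinfun_apply (F' x)) \<le> L" if "x \<in> ball p r" for x
    proof -
      have "dist (F' x) (F' p) < 1" using d(2)[of x] that by (simp add: r_def dist_commute)
      then show ?thesis using norm_triangle_sub[of "F' x" "F' p"]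
        by (simp add: L_def norm_blinfun.rep_eq[symmetric] dist_norm)
    qed
  qed (auto simp: L_def)
  moreover have "0 < r" using d e by (simp add: r_def)
  ultimately show ?thesis using that sub by blast
qed

section \<open>Orthogonal projections\<close>

text \<open>The difference of two candidates lies in \<open>T\<close> and is orthogonal to
  itself.\<close>

lemma orth_proj_unique:
  assumes "subspace T" "y \<in> T" "\<And>z. z \<in> T \<Longrightarrow> orthogonal (x - y) z"
  shows "orth_proj T x = y"
  unfolding orth_proj_def
proof (rule the_equality)
  fix y' assume y': "y' \<in> T \<and> (\<forall>z\<in>T. orthogonal (x - y') z)"
  then have "y' - y \<in> T" using assms subspace_diff by blast
  then have "orthogonal (x - y) (y' - y)" "orthogonal (x - y') (y' - y)" using assms y' by auto
  then have "(y' - y) \<bullet> (y' - y) = 0"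
    by (auto simp: orthogonal_def inner_diff_left inner_diff_right)
  then show "y' = y" by simp
qed (use assms in auto)

lemma orth_proj:
  assumes "subspace T"
  shows orth_proj_mem: "orth_proj T x \<in> T"
    and orth_proj_orthogonal: "z \<in> T \<Longrightarrow> (x - orth_proj T x) \<bullet> z = 0"
proof -
  obtain y w where yw: "y \<in> span T" "\<And>z. z \<in> span T \<Longrightarrow> orthogonal w z" "x = y + w"
    using orthogonal_subspace_decomp_exists by metis
  have "span T = T" using assms by (simp add: span_eq_iff)
  note yw = yw[unfolded this]
  then have "orth_proj T x = y" using assms by (intro orth_proj_unique) auto
  then show "orth_proj T x \<in> T" "z \<in> T \<Longrightarrow> (x - orth_proj T x) \<bullet> z = 0"
    using yw \<open>orth_proj T x = y\<close> by (auto simp: orthogonal_def)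
qed

lemma orth_proj_id: "subspace T \<Longrightarrow> x \<in> T \<Longrightarrow> orth_proj T x = x"
  by (rule orth_proj_unique) (auto simp: orthogonal_def)

lemma orth_proj_zero: "subspace T \<Longrightarrow> (\<And>z. z \<in> T \<Longrightarrow> x \<bullet> z = 0) \<Longrightarrow> orth_proj T x = 0"
  by (rule orth_proj_unique) (auto simp: orthogonal_def subspace_0)

lemma linear_orth_proj:
  assumes T: "subspace T"
  shows "linear (orth_proj T)"
proof
  fix x y c
  show "orth_proj T (x + y) = orth_proj T x + orth_proj T y"
    using orth_proj_orthogonal[OF T, of _ x] orth_proj_orthogonal[OF T, of _ y]
    by (intro orth_proj_unique)
      (auto simp: T subspace_add orth_proj_mem orthogonal_def inner_diff_left inner_add_left)
  show "orth_proj T (c *\<^sub>R x) = c *\<^sub>R orth_proj T x"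
    using orth_proj_orthogonal[OF T, of _ x]
    by (intro orth_proj_unique)
      (auto simp: T subspace_scale orth_proj_mem orthogonal_def inner_diff_left)
qed

lemma orth_proj_inner:
  assumes "subspace T" "y \<in> T"
  shows "orth_proj T x \<bullet> y = x \<bullet> y"
  using orth_proj_orthogonal[OF assms, of x] by (simp add: inner_diff_left)

text \<open>One Gram--Schmidt step: the projection onto the span of one more vector field \<open>w i\<close> arises
  from the previous projection by adding the component along the residual of \<open>w i\<close>.\<close>

lemma C1_on_orth_proj_span:
  fixes w :: "'i \<Rightarrow> 'a::euclidean_space \<Rightarrow> 'b::euclidean_space"
  assumes "finite J" and "open W" and "\<And>j. j \<in> J \<Longrightarrow> C1_on (w j) W"
    and "\<And>x. x \<in> W \<Longrightarrow> inj_on (\<lambda>j. w j x) J" and "\<And>x. x \<in> W \<Longrightarrow> independent ((\<lambda>j. w j x) ` J)"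
  shows "C1_on (\<lambda>x. orth_proj (span ((\<lambda>j. w j x) ` J)) v) W"
  using assms
proof (induction J arbitrary: v rule: finite_induct)
  case empty
  then show ?case using orth_proj_id[of "{0::'b}"] orth_proj_zero[of "{0::'b}"]
    by (simp add: subspace_single_0 C1_on_const)
next
  case (insert i J)
  define P where "P x = orth_proj (span ((\<lambda>j. w j x) ` J))" for x
  have ind: "independent ((\<lambda>j. w j x) ` J)" if "x \<in> W" for x
    using insert.prems(4)[OF that] by (simp add: independent_mono subset_insertI)
  have P: "C1_on (\<lambda>x. P x v) W" for v
    unfolding P_def using insert.prems ind by (intro insert.IH) (auto simp: inj_on_def)
  define r where "r x = w i x - P x (w i x)" for x
  have lin: "linear (P x)" for x unfolding P_def by (rule linear_orth_proj) (rule subspace_span)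
  \<comment> \<open>The induction hypothesis concerns constant vectors, but \<open>w i x\<close>
    moves with \<open>x\<close>; expanding it in the fixed basis separates the two
    dependences.\<close>
  have "P x (w i x) = (\<Sum>b\<in>Basis. (w i x \<bullet> b) *\<^sub>R P x b)" for x
  proof -
    have "P x (w i x) = P x (\<Sum>b\<in>Basis. (w i x \<bullet> b) *\<^sub>R b)" by (simp add: euclidean_representation)
    also have "\<dots> = (\<Sum>b\<in>Basis. (w i x \<bullet> b) *\<^sub>R P x b)"
      by (simp add: linear_sum[OF lin] linear_scale[OF lin])
    finally show ?thesis .
  qed
  then have r: "C1_on r W" unfolding r_def
    using insert.prems(2)[of i] by (auto intro!: C1_on_diff C1_on_sum C1_on_scaleR C1_on_inner P C1_on_const)
  have r0: "r x \<bullet> r x \<noteq> 0" if "x \<in> W" for x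
  proof
    assume "r x \<bullet> r x = 0"
    then have "w i x = P x (w i x)" by (simp add: r_def)
    then have "w i x \<in> span ((\<lambda>j. w j x) ` J)" unfolding P_def by (metis orth_proj_mem subspace_span)
    moreover have "w i x \<notin> (\<lambda>j. w j x) ` J"
      using insert.prems(3)[OF that] insert.hyps(2) by (auto simp: inj_on_def)
    ultimately show False
      using insert.prems(4)[OF that] by (simp add: independent_insert)
  qed
  have c: "C1_on (\<lambda>x. P x v + ((v \<bullet> r x) / (r x \<bullet> r x)) *\<^sub>R r x) W"
    using r0 by (intro C1_on_add P C1_on_scaleR C1_on_divide C1_on_inner r C1_on_const)
  have eq: "orth_proj (span ((\<lambda>j. w j x) ` insert i J)) v = P x v + ((v \<bullet> r x) / (r x \<bullet> r x)) *\<^sub>R r x"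
    if x: "x \<in> W" for x
  proof (rule orth_proj_unique)
    let ?T = "span ((\<lambda>j. w j x) ` J)"
    have PT: "P x u \<in> ?T" for u unfolding P_def by (rule orth_proj_mem) (rule subspace_span)
    have Po: "(u - P x u) \<bullet> z = 0" if "z \<in> ?T" for u z
      unfolding P_def by (rule orth_proj_orthogonal[OF subspace_span that])
    have sub: "?T \<subseteq> span ((\<lambda>j. w j x) ` insert i J)" by (intro span_mono) auto
    have wi: "w i x \<in> span ((\<lambda>j. w j x) ` insert i J)" by (intro span_base) auto
    have rs: "r x \<in> span ((\<lambda>j. w j x) ` insert i J)"
      unfolding r_def using PT sub wi by (auto intro: span_diff)
    then show "P x v + ((v \<bullet> r x) / (r x \<bullet> r x)) *\<^sub>R r x \<in> span ((\<lambda>j. w j x) ` insert i J)"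
      using PT sub by (auto intro: span_add span_scale)
    fix z assume z: "z \<in> span ((\<lambda>j. w j x) ` insert i J)"
    let ?u = "v - (P x v + ((v \<bullet> r x) / (r x \<bullet> r x)) *\<^sub>R r x)"
    have Tz: "?u \<bullet> t = 0" if "t \<in> ?T" for t
      using Po[OF that, of v] Po[OF that, of "w i x"]
      by (simp add: r_def[symmetric] inner_diff_left inner_add_left)
    have "?u \<bullet> r x = 0"
      using r0[OF x] Po[OF PT, of "w i x" v]
      by (simp add: r_def[symmetric] inner_diff_left inner_diff_right inner_add_right inner_add_left inner_commute)
    then have "?u \<bullet> w i x = 0"
      using Tz[OF PT, of "w i x"] by (simp add: r_def inner_diff_right)
    then have "orthogonal ?u z' " if "z' \<in> (\<lambda>j. w j x) ` insert i J" for z'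
      using that Tz by (auto simp: orthogonal_def intro: span_base)
    then show "orthogonal ?u z" using z orthogonal_to_span by blast
  qed simp
  show ?case by (rule C1_on_cong[OF c insert.prems(1) eq[symmetric]])
qed

section \<open>Tangent spaces of submanifolds\<close>

lemma tangent_spaceI:
  assumes "0 < \<epsilon>" "C1_on \<gamma> {-\<epsilon><..<\<epsilon>}" "\<gamma> ` {-\<epsilon><..<\<epsilon>} \<subseteq> M" "\<gamma> 0 = p" "(\<gamma> has_vector_derivative v) (at 0)"
  shows "v \<in> tangent_space M p"
  using assms unfolding tangent_space_def by auto

lemma tangent_spaceE:
  assumes "v \<in> tangent_space M p"
  obtains \<gamma> \<epsilon> where "0 < \<epsilon>" "C1_on \<gamma> {-\<epsilon><..<\<epsilon>}" "\<gamma> ` {-\<epsilon><..<\<epsilon>} \<subseteq> M" "\<gamma> 0 = p" "(\<gamma> has_vector_derivative v) (at 0)"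
  using assms unfolding tangent_space_def by auto

lemma tangent_space_mono: "M \<subseteq> N \<Longrightarrow> tangent_space M p \<subseteq> tangent_space N p"
  by (rule subsetI, elim tangent_spaceE, rule tangent_spaceI) blast+

locale submanifold_chart =
  fixes k :: nat and M :: "'a::euclidean_space set" and W V :: "'a set" and \<phi> \<psi> :: "'a \<Rightarrow> 'a" and S :: "'a set"
  assumes open_W: "open W" and open_V: "open V" and homeo: "homeomorphism W V \<phi> \<psi>"
    and C2_\<phi>: "C2_on \<phi> W" and C2_\<psi>: "C2_on \<psi> V"
    and subspace_S: "subspace S" and dim_S: "dim S = k" and image: "\<phi> ` (M \<inter> W) = S \<inter> V"
begin

lemma \<psi>_\<phi>: "x \<in> W \<Longrightarrow> \<psi> (\<phi> x) = x" and \<phi>_\<psi>: "y \<in> V \<Longrightarrow> \<phi> (\<psi> y) = y"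
  and \<phi>_V: "x \<in> W \<Longrightarrow> \<phi> x \<in> V" and \<psi>_W: "y \<in> V \<Longrightarrow> \<psi> y \<in> W"
  using homeo by (auto simp: homeomorphism_def)

lemma \<phi>_S: "x \<in> M \<Longrightarrow> x \<in> W \<Longrightarrow> \<phi> x \<in> S"
  using image by blast

lemma \<psi>_M:
  assumes "y \<in> S" "y \<in> V"
  shows "\<psi> y \<in> M"
proof -
  obtain x where "x \<in> M \<inter> W" "y = \<phi> x" using assms image by blast
  then show ?thesis using \<psi>_\<phi> by simp
qed

text \<open>\<open>A x\<close> is the derivative of the parametrisation \<open>\<psi>\<close> at \<open>\<phi> x\<close>.\<close>

lemma derivative_frame:
  obtains A where
    "\<And>v. C1_on (\<lambda>x. A x v) W"
    "\<And>x. x \<in> W \<Longrightarrow> linear (A x)" "\<And>x. x \<in> W \<Longrightarrow> inj (A x)"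
    "\<And>x. x \<in> M \<inter> W \<Longrightarrow> tangent_space M x = A x ` S"
proof -
  obtain \<psi>' where \<psi>': "\<And>y. y \<in> V \<Longrightarrow> (\<psi> has_derivative blinfun_apply (\<psi>' y)) (at y)" "C1_on \<psi>' V"
    using C2_onE[OF C2_\<psi>] by blast
  obtain \<phi>' where \<phi>': "\<And>x. x \<in> W \<Longrightarrow> (\<phi> has_derivative blinfun_apply (\<phi>' x)) (at x)" "C1_on \<phi>' W"
    using C2_onE[OF C2_\<phi>] by blast
  define A where "A x = blinfun_apply (\<psi>' (\<phi> x))" for x
  have \<psi>\<phi>': "A x (\<phi>' x v) = v" if "x \<in> W" for x v
  proof -
    have "((\<lambda>x. \<psi> (\<phi> x)) has_derivative (\<lambda>v. A x (\<phi>' x v))) (at x)"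
      unfolding A_def using has_derivative_compose[OF \<phi>'(1)[OF that] \<psi>'(1)[OF \<phi>_V[OF that]]] .
    moreover have "((\<lambda>x. \<psi> (\<phi> x)) has_derivative (\<lambda>v. v)) (at x)"
      by (rule has_derivative_transform_within_open[OF has_derivative_ident open_W that]) (simp add: \<psi>_\<phi>)
    ultimately have "(\<lambda>v. A x (\<phi>' x v)) = (\<lambda>v. v)" by (rule has_derivative_unique)
    then show ?thesis by (rule fun_cong)
  qed
  have \<phi>\<psi>': "\<phi>' x (A x v) = v" if "x \<in> W" for x v
  proof -
    have "((\<lambda>y. \<phi> (\<psi> y)) has_derivative (\<lambda>v. \<phi>' (\<psi> (\<phi> x)) (\<psi>' (\<phi> x) v))) (at (\<phi> x))"
      by (rule has_derivative_compose[OF \<psi>'(1) \<phi>'(1)]) (use that in \<open>simp_all add: \<phi>_V \<psi>_\<phi>\<close>)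
    moreover have "((\<lambda>y. \<phi> (\<psi> y)) has_derivative (\<lambda>v. v)) (at (\<phi> x))"
      by (rule has_derivative_transform_within_open[OF has_derivative_ident open_V \<phi>_V[OF that]]) (simp add: \<phi>_\<psi>)
    ultimately have "(\<lambda>v. \<phi>' (\<psi> (\<phi> x)) (\<psi>' (\<phi> x) v)) = (\<lambda>v. v)" by (rule has_derivative_unique)
    then show ?thesis using that by (simp add: A_def \<psi>_\<phi> fun_eq_iff)
  qed
  show ?thesis
  proof (rule that[of A])
    fix v
    have "C1_on (\<lambda>x. \<psi>' (\<phi> x)) W"
      by (rule C1_on_compose[OF \<psi>'(2) C2_on_imp_C1_on[OF C2_\<phi>]]) (use \<phi>_V in auto)
    then show "C1_on (\<lambda>x. A x v) W"
      unfolding A_def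
      by (rule C1_on_compose[where G="\<lambda>F. blinfun_apply F v" and V=UNIV, rotated])
        (auto intro: C1_on_bounded_linear blinfun.bounded_linear_left)
  next
    fix x assume x: "x \<in> W"
    show "linear (A x)" unfolding A_def by (rule bounded_linear.linear) (rule blinfun.bounded_linear_right)
    show "inj (A x)" by (rule inj_on_inverseI[where g="\<phi>' x"]) (rule \<phi>\<psi>'[OF x])
  next
    fix x assume x: "x \<in> M \<inter> W"
    show "tangent_space M x = A x ` S"
    proof
      show "A x ` S \<subseteq> tangent_space M x"
      proof
        fix u assume "u \<in> A x ` S"
        then obtain s where s: "s \<in> S" "u = A x s" by blast
        \<comment> \<open>The straight line through \<open>\<phi> x\<close> in direction
          \<open>s\<close> stays in \<open>S\<close>; its image under \<open>\<psi>\<close> is the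
          required curve in \<open>M\<close>.\<close>
        define l where "l t = \<phi> x + t *\<^sub>R s" for t
        have l0: "l 0 \<in> V" using x by (simp add: l_def \<phi>_V)
        have lC1: "C1_on l X" for X unfolding l_def
          by (intro C1_on_add C1_on_const C1_on_scaleR C1_on_bounded_linear bounded_linear_ident)
        have "open (l -` V)"
          by (rule open_vimage[OF open_V]) (simp add: l_def continuous_intros)
        then obtain \<epsilon> where \<epsilon>: "0 < \<epsilon>" "ball 0 \<epsilon> \<subseteq> l -` V"
          using l0 open_contains_ball by (metis vimageI)
        have ball: "ball 0 \<epsilon> = {-\<epsilon><..<\<epsilon>}" by (auto simp: ball_eq_greaterThanLessThan)
        show "u \<in> tangent_space M x"
        proof (rule tangent_spaceI[OF \<epsilon>(1), where \<gamma>="\<lambda>t. \<psi> (l t)"])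
          show "C1_on (\<lambda>t. \<psi> (l t)) {-\<epsilon><..<\<epsilon>}"
            using \<epsilon>(2) ball by (intro C1_on_compose[OF C2_on_imp_C1_on[OF C2_\<psi>] lC1]) auto
          show "(\<lambda>t. \<psi> (l t)) ` {-\<epsilon><..<\<epsilon>} \<subseteq> M"
          proof clarify
            fix t assume "t \<in> {-\<epsilon><..<\<epsilon>}"
            then have "l t \<in> V" using \<epsilon>(2) ball by auto
            moreover have "l t \<in> S" using s(1) x by (simp add: l_def \<phi>_S subspace_add subspace_scale subspace_S)
            ultimately show "\<psi> (l t) \<in> M" by (rule \<psi>_M[rotated])
          qed
          show "\<psi> (l 0) = x" using x by (simp add: l_def \<psi>_\<phi>)
          have "(l has_derivative (\<lambda>t. t *\<^sub>R s)) (at 0)"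
            unfolding l_def by (auto intro!: derivative_eq_intros)
          then have "((\<lambda>t. \<psi> (l t)) has_derivative (\<lambda>t. \<psi>' (l 0) (t *\<^sub>R s))) (at 0)"
            by (rule has_derivative_compose[where g=\<psi>]) (rule \<psi>'(1)[OF l0])
          then show "((\<lambda>t. \<psi> (l t)) has_vector_derivative u) (at 0)"
            using s by (simp add: has_vector_derivative_def blinfun.scaleR_right A_def l_def)
        qed
      qed
      show "tangent_space M x \<subseteq> A x ` S"
      proof
        fix v assume "v \<in> tangent_space M x"
        then obtain \<gamma> \<epsilon> where \<gamma>: "0 < \<epsilon>" "C1_on \<gamma> {-\<epsilon><..<\<epsilon>}" "\<gamma> ` {-\<epsilon><..<\<epsilon>} \<subseteq> M" "\<gamma> 0 = x"
            "(\<gamma> has_vector_derivative v) (at 0)"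
          by (rule tangent_spaceE)
        have "(\<phi> has_derivative blinfun_apply (\<phi>' (\<gamma> 0))) (at (\<gamma> 0))"
          using x \<gamma>(4) \<phi>'(1) by simp
        with \<gamma>(5)[unfolded has_vector_derivative_def]
        have "((\<lambda>t. \<phi> (\<gamma> t)) has_derivative (\<lambda>t. \<phi>' (\<gamma> 0) (t *\<^sub>R v))) (at 0)"
          by (rule has_derivative_compose)
        then have "((\<lambda>t. \<phi> (\<gamma> t)) has_vector_derivative \<phi>' x v) (at 0)"
          by (simp add: has_vector_derivative_def blinfun.scaleR_right \<gamma>(4))
        \<comment> \<open>The component of \<open>\<phi>' x v\<close> normal to \<open>S\<close>.
          Since \<open>\<phi> (\<gamma> t)\<close> stays in \<open>S\<close> for small
          \<open>t\<close>, its pairing with \<open>z\<close> is constantly 0, and the derivative of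
          this pairing at 0 is \<open>z \<bullet> z\<close>.\<close>
        define z where "z = \<phi>' x v - orth_proj S (\<phi>' x v)"
        have zS: "z \<bullet> y = 0" if "y \<in> S" for y
          unfolding z_def by (rule orth_proj_orthogonal[OF subspace_S that])
        have "continuous (at 0) \<gamma>" using \<gamma>(5) by (rule has_vector_derivative_continuous)
        then have "(\<gamma> \<longlongrightarrow> x) (at 0)" using \<gamma>(4) by (simp add: continuous_at)
        then have "\<forall>\<^sub>F t in at 0. \<gamma> t \<in> W" by (rule topological_tendstoD) (use x open_W in auto)
        moreover have "\<forall>\<^sub>F t in at 0. t \<in> {-\<epsilon><..<\<epsilon>}"
          using \<gamma>(1) by (intro eventually_at_in_open') auto
        ultimately have ev: "\<forall>\<^sub>F t in at 0. z \<bullet> \<phi> (\<gamma> t) = 0"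
        proof eventually_elim
          case (elim t)
          then show ?case using \<gamma>(3) by (intro zS \<phi>_S) auto
        qed
        have "((\<lambda>t. z \<bullet> \<phi> (\<gamma> t)) has_derivative (\<lambda>t. z \<bullet> (t *\<^sub>R \<phi>' x v))) (at 0)"
          using \<open>((\<lambda>t. \<phi> (\<gamma> t)) has_vector_derivative \<phi>' x v) (at 0)\<close>
          unfolding has_vector_derivative_def by (rule has_derivative_inner_right)
        then have "((\<lambda>t. 0) has_derivative (\<lambda>t. z \<bullet> (t *\<^sub>R \<phi>' x v))) (at 0)"
          by (rule has_derivative_transform_eventually[OF _ ev]) (use zS \<phi>_S x \<gamma>(4) in auto)
        then have "(\<lambda>t. z \<bullet> (t *\<^sub>R \<phi>' x v)) = (\<lambda>t. 0)"
          by (rule has_derivative_unique) (rule has_derivative_const)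
        then have "z \<bullet> (1 *\<^sub>R \<phi>' x v) = 0" by (rule fun_cong)
        then have "z \<bullet> z = 0"
          using zS[OF orth_proj_mem[OF subspace_S]] by (simp add: z_def inner_diff_right)
        then have "\<phi>' x v = orth_proj S (\<phi>' x v)" by (simp add: z_def)
        then have "\<phi>' x v \<in> S" using orth_proj_mem[OF subspace_S] by metis
        then show "v \<in> A x ` S" using \<psi>\<phi>'[of x v] x by (intro image_eqI[of _ _ "\<phi>' x v"]) auto
      qed
    qed
  qed
qed

lemma subspace_tangent: "x \<in> M \<inter> W \<Longrightarrow> subspace (tangent_space M x)"
  and dim_tangent: "x \<in> M \<inter> W \<Longrightarrow> dim (tangent_space M x) = k"
proof -
  assume x: "x \<in> M \<inter> W"
  obtain A where A: "\<And>x. x \<in> W \<Longrightarrow> linear (A x)" "\<And>x. x \<in> W \<Longrightarrow> inj (A x)"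
    "\<And>x. x \<in> M \<inter> W \<Longrightarrow> tangent_space M x = A x ` S"
    by (rule derivative_frame) blast
  show "subspace (tangent_space M x)"
    using A x by (simp add: linear_subspace_image subspace_S)
  show "dim (tangent_space M x) = k"
    using A x dim_image_eq[of "A x" S] dim_S inj_on_subset[OF A(2) subset_UNIV] by simp
qed

text \<open>Gram-Schmidt is applied to the vectors \<open>A x s\<close>, with \<open>s\<close> in a
  basis of \<open>S\<close>. They are defined on all of \<open>W\<close>, not only on
  \<open>M\<close>, and so yield the extension to an open set that \<open>C1_along\<close>
  requires.\<close>

lemma C1_tangent_projection:
  obtains P where "C1_on P W" "\<And>x. x \<in> M \<inter> W \<Longrightarrow> P x = orth_proj (tangent_space M x) v"
proof -
  obtain A where A: "\<And>v. C1_on (\<lambda>x. A x v) W"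
    "\<And>x. x \<in> W \<Longrightarrow> linear (A x)" "\<And>x. x \<in> W \<Longrightarrow> inj (A x)"
    "\<And>x. x \<in> M \<inter> W \<Longrightarrow> tangent_space M x = A x ` S"
    by (rule derivative_frame) blast
  obtain D where D: "D \<subseteq> S" "independent D" "S \<subseteq> span D" by (rule basis_exists) blast
  have spanD: "span D = S" using D subspace_S by (simp add: span_subspace)
  have "C1_on (\<lambda>x. orth_proj (span ((\<lambda>s. A x s) ` D)) v) W"
  proof (rule C1_on_orth_proj_span[OF independent_imp_finite[OF D(2)] open_W A(1)])
    fix x assume x: "x \<in> W"
    show "inj_on (\<lambda>s. A x s) D" by (rule inj_on_subset[OF A(3)[OF x]]) simp
    show "independent ((\<lambda>s. A x s) ` D)"
      using linear_independent_injective_image[OF A(2)[OF x] D(2)] inj_on_subset[OF A(3)[OF x] subset_UNIV] by simp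
  qed
  moreover have "orth_proj (span ((\<lambda>s. A x s) ` D)) v = orth_proj (tangent_space M x) v" if "x \<in> M \<inter> W" for x
    using A(4)[OF that] linear_span_image[OF A(2), of x D] that spanD by simp
  ultimately show ?thesis by (rule that)
qed

end

lemma C2_submanifold_chart:
  assumes "C2_submanifold k M" "p \<in> M"
  obtains W V \<phi> \<psi> S where "submanifold_chart k M W V \<phi> \<psi> S" "p \<in> W"
  using assms unfolding C2_submanifold_def submanifold_chart_def by metis

lemma subspace_tangent_space: "C2_submanifold k M \<Longrightarrow> p \<in> M \<Longrightarrow> subspace (tangent_space M p)"
  by (metis C2_submanifold_chart IntI submanifold_chart.subspace_tangent)

lemma dim_tangent_space: "C2_submanifold k M \<Longrightarrow> p \<in> M \<Longrightarrow> dim (tangent_space M p) = k"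
  by (metis C2_submanifold_chart IntI submanifold_chart.dim_tangent)

lemma C1_alongI:
  assumes "\<And>p. p \<in> M \<Longrightarrow> \<exists>W Y. open W \<and> p \<in> W \<and> C1_on Y W \<and> (\<forall>x\<in>M \<inter> W. Y x = X x)"
  shows "C1_along M X"
  using assms by (simp add: C1_along_def)

lemma C1_along_tangent_projection:
  assumes "C2_submanifold k M"
  shows "C1_along M (\<lambda>x. orth_proj (tangent_space M x) v)"
proof (rule C1_alongI)
  fix p assume "p \<in> M"
  then obtain W V \<phi> \<psi> S where ch: "submanifold_chart k M W V \<phi> \<psi> S" "p \<in> W"
    using C2_submanifold_chart[OF assms] by blast
  obtain P where "C1_on P W" "\<And>x. x \<in> M \<inter> W \<Longrightarrow> P x = orth_proj (tangent_space M x) v"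
    using submanifold_chart.C1_tangent_projection[OF ch(1)] by blast
  then show "\<exists>W Y. open W \<and> p \<in> W \<and> C1_on Y W \<and> (\<forall>x\<in>M \<inter> W. Y x = orth_proj (tangent_space M x) v)"
    using submanifold_chart.open_W[OF ch(1)] ch(2) by auto
qed

section \<open>Derivatives along a submanifold and the second fundamental form\<close>

lemma has_derivative_transform_local:
  assumes X: "(X has_derivative X') (at p within M)" and "p \<in> M" "open W" "p \<in> W"
    and eq: "\<And>x. x \<in> M \<Longrightarrow> x \<in> W \<Longrightarrow> X x = Y x"
  shows "(Y has_derivative X') (at p within M)"
proof -
  obtain d where d: "0 < d" "ball p d \<subseteq> W" using assms(3,4) open_contains_ball by metis
  show ?thesis
    by (rule has_derivative_transform_within[OF X d(1) \<open>p \<in> M\<close>])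
      (use d(2) in \<open>auto intro!: eq simp: dist_commute subset_iff\<close>)
qed

lemma C1_alongE:
  assumes "C1_along M X" "p \<in> M"
  obtains W Y where "open W" "p \<in> W" "C1_on Y W" "\<And>x. x \<in> M \<Longrightarrow> x \<in> W \<Longrightarrow> Y x = X x"
proof -
  from assms obtain W Y where "open W \<and> p \<in> W \<and> C1_on Y W \<and> (\<forall>x\<in>M \<inter> W. Y x = X x)"
    unfolding C1_along_def by meson
  then show ?thesis by (intro that[of W Y]) auto
qed

lemma C1_along_differentiable:
  assumes "C1_along M X" "p \<in> M"
  shows "X differentiable (at p within M)"
proof -
  obtain W Y where Y: "open W" "p \<in> W" "C1_on Y W" "\<And>x. x \<in> M \<Longrightarrow> x \<in> W \<Longrightarrow> Y x = X x"
    using C1_alongE[OF assms] by blast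
  obtain Y' where "(Y has_derivative Y') (at p within M)"
    using C1_on_differentiable[OF Y(3,2)] has_derivative_at_withinI unfolding differentiable_def by blast
  then have "(X has_derivative Y') (at p within M)"
    by (rule has_derivative_transform_local[OF _ assms(2) Y(1,2,4)])
  then show ?thesis unfolding differentiable_def by blast
qed

lemma C1_along_continuous: "C1_along M X \<Longrightarrow> continuous_on M X"
  unfolding continuous_on_eq_continuous_within
  using C1_along_differentiable differentiable_imp_continuous_within by blast

text \<open>A derivative within \<open>M\<close> is only determined on tangent vectors: there it can be read off
  from curves.\<close>

lemma has_derivative_within_unique_tangent:
  assumes X': "(X has_derivative X') (at p within M)" and X'': "(X has_derivative X'') (at p within M)"
    and u: "u \<in> tangent_space M p"
  shows "X' u = X'' u"
proof -
  obtain \<gamma> \<epsilon> where \<gamma>: "0 < \<epsilon>" "C1_on \<gamma> {-\<epsilon><..<\<epsilon>}" "\<gamma> ` {-\<epsilon><..<\<epsilon>} \<subseteq> M" "\<gamma> 0 = p"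
      "(\<gamma> has_vector_derivative u) (at 0)"
    using u by (rule tangent_spaceE)
  let ?I = "{-\<epsilon><..<\<epsilon>}"
  have *: "((\<lambda>t. X (\<gamma> t)) has_derivative (\<lambda>t. D (t *\<^sub>R u))) (at 0)"
    if D: "(X has_derivative D) (at p within M)" for D
  proof -
    have "(\<gamma> has_derivative (\<lambda>t. t *\<^sub>R u)) (at 0 within ?I)"
      using \<gamma>(5) unfolding has_vector_derivative_def by (rule has_derivative_at_withinI)
    moreover have "(X has_derivative D) (at (\<gamma> 0) within \<gamma> ` ?I)"
      unfolding \<gamma>(4) by (rule has_derivative_subset[OF D \<gamma>(3)])
    ultimately have "((\<lambda>t. X (\<gamma> t)) has_derivative (\<lambda>t. D (t *\<^sub>R u))) (at 0 within ?I)"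
      by (rule has_derivative_in_compose)
    then show ?thesis using \<gamma>(1) by (subst (asm) at_within_open) auto
  qed
  have "(\<lambda>t. X' (t *\<^sub>R u)) = (\<lambda>t. X'' (t *\<^sub>R u))"
    by (rule has_derivative_unique[OF *[OF X'] *[OF X'']])
  from fun_cong[OF this, of 1] show ?thesis by simp
qed

lemma D_along_eq:
  assumes "(X has_derivative X') (at p within M)" "u \<in> tangent_space M p"
  shows "D_along M X p u = X' u"
  unfolding D_along_def
proof (rule the_equality)
  show "w = X' u" if w: "\<exists>X'. (X has_derivative X') (at p within M) \<and> w = X' u" for w
  proof -
    obtain D where D: "(X has_derivative D) (at p within M)" "w = D u" using w by auto
    show ?thesis unfolding D(2) by (rule has_derivative_within_unique_tangent[OF D(1) assms])
  qed
qed (use assms in auto)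

lemma D_along_cong:
  assumes "X differentiable (at p within M)" "u \<in> tangent_space M p" "p \<in> M" "open W" "p \<in> W"
    "\<And>x. x \<in> M \<Longrightarrow> x \<in> W \<Longrightarrow> X x = Y x"
  shows "D_along M Y p u = D_along M X p u"
proof -
  obtain X' where X': "(X has_derivative X') (at p within M)" using assms(1) unfolding differentiable_def by blast
  then have "(Y has_derivative X') (at p within M)"
    by (rule has_derivative_transform_local[OF _ assms(3-6)])
  then show ?thesis using X' assms(2) by (simp add: D_along_eq)
qed

text \<open>\<open>D_along\<close> is meaningful only on tangent vectors; inserting the projection
  gives a map that is linear on the whole space.\<close>

lemma D_along_linear:
  assumes X: "X differentiable (at p within M)" and T: "subspace (tangent_space M p)"
  shows "linear (\<lambda>u. D_along M X p (orth_proj (tangent_space M p) u))"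
proof -
  obtain X' where X': "(X has_derivative X') (at p within M)" using X unfolding differentiable_def by blast
  have "(\<lambda>u. D_along M X p (orth_proj (tangent_space M p) u)) = X' \<circ> orth_proj (tangent_space M p)"
    using D_along_eq[OF X'] orth_proj_mem[OF T] by (simp add: fun_eq_iff)
  then show ?thesis
    using linear_compose[OF linear_orth_proj[OF T] has_derivative_linear[OF X']] by simp
qed

text \<open>Locally the field is the restriction of a C1 map, whose derivative varies continuously
  in operator norm and so may be applied to a continuously varying vector.\<close>

lemma continuous_on_D_along:
  assumes X: "C1_along M X" and Z: "continuous_on M Z" and ZT: "\<And>p. p \<in> M \<Longrightarrow> Z p \<in> tangent_space M p"
  shows "continuous_on M (\<lambda>p. D_along M X p (Z p))"
  unfolding continuous_on_eq_continuous_within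
proof
  fix p assume p: "p \<in> M"
  obtain W Y where Y: "open W" "p \<in> W" "C1_on Y W" "\<And>x. x \<in> M \<Longrightarrow> x \<in> W \<Longrightarrow> Y x = X x"
    using C1_alongE[OF X p] by blast
  obtain Y' where Y': "\<And>x. x \<in> W \<Longrightarrow> (Y has_derivative blinfun_apply (Y' x)) (at x)" "continuous_on W Y'"
    using C1_on_blinfunE[OF Y(3)] by blast
  have eq: "D_along M X q (Z q) = blinfun_apply (Y' q) (Z q)" if "q \<in> M" "q \<in> W" for q
  proof (rule D_along_eq[OF _ ZT[OF that(1)]])
    show "(X has_derivative blinfun_apply (Y' q)) (at q within M)"
      by (rule has_derivative_transform_local[OF has_derivative_at_withinI[OF Y'(1)[OF that(2)]] that(1) Y(1) that(2) Y(4)])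
  qed
  have "isCont Y' p" using Y'(2) Y(1,2) continuous_on_eq_continuous_at by blast
  then have "((\<lambda>q. blinfun_apply (Y' q) (Z q)) \<longlongrightarrow> blinfun_apply (Y' p) (Z p)) (at p within M)"
    using Z p unfolding continuous_on_def
    by (intro bounded_bilinear.tendsto[OF bounded_bilinear_blinfun_apply])
      (auto simp: continuous_at intro: tendsto_within_subset)
  then have "((\<lambda>q. D_along M X q (Z q)) \<longlongrightarrow> blinfun_apply (Y' p) (Z p)) (at p within M)"
  proof (rule Lim_transform_eventually)
    have "\<forall>\<^sub>F q in at p within M. q \<in> M \<and> q \<in> W"
      unfolding eventually_at_topological using Y(1,2) by blast
    then show "\<forall>\<^sub>F q in at p within M. blinfun_apply (Y' q) (Z q) = D_along M X q (Z q)"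
      by eventually_elim (simp add: eq)
  qed
  then show "continuous (at p within M) (\<lambda>p. D_along M X p (Z p))"
    using eq[OF p Y(2)] by (simp add: continuous_within)
qed

text \<open>The derivative of the tangential projection; on tangent vectors it is the second fundamental
  form in Euclidean space.\<close>

definition dproj :: "'a::euclidean_space set \<Rightarrow> 'a \<Rightarrow> 'a \<Rightarrow> 'a \<Rightarrow> 'a" where
  "dproj M p u v = D_along M (\<lambda>x. orth_proj (tangent_space M x) v) p u"

locale C2_manifold =
  fixes k :: nat and M :: "'a::euclidean_space set"
  assumes C2: "C2_submanifold k M"
begin

abbreviation T :: "'a \<Rightarrow> 'a set" where "T p \<equiv> tangent_space M p"
abbreviation P :: "'a \<Rightarrow> 'a \<Rightarrow> 'a" where "P p \<equiv> orth_proj (T p)"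

lemma subspace_T: "p \<in> M \<Longrightarrow> subspace (T p)"
  by (rule subspace_tangent_space[OF C2])

lemma differentiable_P: "p \<in> M \<Longrightarrow> (\<lambda>x. P x v) differentiable (at p within M)"
  by (rule C1_along_differentiable[OF C1_along_tangent_projection[OF C2]])

lemma P_representation:
  assumes "p \<in> M"
  shows "P p v = (\<Sum>b\<in>Basis. (v \<bullet> b) *\<^sub>R P p b)"
proof -
  have "P p v = P p (\<Sum>b\<in>Basis. (v \<bullet> b) *\<^sub>R b)" by (simp add: euclidean_representation)
  then show ?thesis
    by (simp add: linear_sum[OF linear_orth_proj[OF subspace_T[OF assms]]]
        linear_scale[OF linear_orth_proj[OF subspace_T[OF assms]]])
qed

text \<open>Product rule for a projection whose base point and argument both move. In the fixed
  basis only the fields \<open>P x b\<close> with constant argument have to be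
  differentiated.\<close>

lemma has_derivative_P_field:
  assumes p: "p \<in> M" and Y: "(Y has_derivative Y') (at p within M)"
    and Q: "\<And>b. ((\<lambda>x. P x b) has_derivative Q b) (at p within M)"
  shows "((\<lambda>x. P x (Y x)) has_derivative (\<lambda>u. P p (Y' u) + (\<Sum>b\<in>Basis. (Y p \<bullet> b) *\<^sub>R Q b u))) (at p within M)"
proof -
  have "((\<lambda>x. \<Sum>b\<in>Basis. (Y x \<bullet> b) *\<^sub>R P x b) has_derivative
      (\<lambda>u. \<Sum>b\<in>Basis. (Y p \<bullet> b) *\<^sub>R Q b u + (Y' u \<bullet> b) *\<^sub>R P p b)) (at p within M)"
    by (intro has_derivative_sum has_derivative_scaleR has_derivative_inner_left Y Q)
  moreover have "(\<Sum>b\<in>Basis. (Y p \<bullet> b) *\<^sub>R Q b u + (Y' u \<bullet> b) *\<^sub>R P p b)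
      = P p (Y' u) + (\<Sum>b\<in>Basis. (Y p \<bullet> b) *\<^sub>R Q b u)" for u
    using P_representation[OF p, of "Y' u"] by (simp add: sum.distrib add.commute)
  ultimately have "((\<lambda>x. \<Sum>b\<in>Basis. (Y x \<bullet> b) *\<^sub>R P x b) has_derivative
      (\<lambda>u. P p (Y' u) + (\<Sum>b\<in>Basis. (Y p \<bullet> b) *\<^sub>R Q b u))) (at p within M)" by simp
  then show ?thesis
    by (rule has_derivative_transform[rotated 2]) (use p in \<open>simp_all add: P_representation[symmetric]\<close>)
qed

lemma dproj_expand:
  assumes p: "p \<in> M" and u: "u \<in> T p"
  shows "dproj M p u v = (\<Sum>b\<in>Basis. (v \<bullet> b) *\<^sub>R dproj M p u b)"
proof -
  have "\<exists>Q. \<forall>b. ((\<lambda>x. P x b) has_derivative Q b) (at p within M)"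
    using differentiable_P[OF p] unfolding differentiable_def by (intro choice) blast
  then obtain Q where Q: "\<And>b. ((\<lambda>x. P x b) has_derivative Q b) (at p within M)" by blast
  have "((\<lambda>x. P x v) has_derivative (\<lambda>u. P p 0 + (\<Sum>b\<in>Basis. (v \<bullet> b) *\<^sub>R Q b u))) (at p within M)"
    by (rule has_derivative_P_field[OF p has_derivative_const Q])
  then have "dproj M p u v = P p 0 + (\<Sum>b\<in>Basis. (v \<bullet> b) *\<^sub>R Q b u)"
    unfolding dproj_def by (rule D_along_eq[OF _ u])
  also have "\<dots> = (\<Sum>b\<in>Basis. (v \<bullet> b) *\<^sub>R dproj M p u b)"
    using D_along_eq[OF Q u] by (simp add: dproj_def orth_proj_zero subspace_T p)
  finally show ?thesis .
qed

lemma linear_dproj: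
  assumes p: "p \<in> M" and u: "u \<in> T p"
  shows "linear (dproj M p u)"
proof
  show "dproj M p u (v + w) = dproj M p u v + dproj M p u w" for v w
    by (simp add: dproj_expand[OF p u, of "v + w"] dproj_expand[OF p u, of v] dproj_expand[OF p u, of w]
        inner_add_left scaleR_add_left sum.distrib)
  show "dproj M p u (c *\<^sub>R v) = c *\<^sub>R dproj M p u v" for c v
    by (simp add: dproj_expand[OF p u, of "c *\<^sub>R v"] dproj_expand[OF p u, of v] scaleR_sum_right)
qed

lemma D_along_P_field:
  assumes p: "p \<in> M" and u: "u \<in> T p" and Y: "Y differentiable (at p within M)"
  shows "D_along M (\<lambda>x. P x (Y x)) p u = P p (D_along M Y p u) + dproj M p u (Y p)"
proof -
  have "\<exists>Q. \<forall>b. ((\<lambda>x. P x b) has_derivative Q b) (at p within M)"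
    using differentiable_P[OF p] unfolding differentiable_def by (intro choice) blast
  then obtain Q where Q: "\<And>b. ((\<lambda>x. P x b) has_derivative Q b) (at p within M)" by blast
  obtain Y' where Y': "(Y has_derivative Y') (at p within M)" using Y unfolding differentiable_def by blast
  have "dproj M p u b = Q b u" for b unfolding dproj_def by (rule D_along_eq[OF Q u])
  then show ?thesis
    unfolding D_along_eq[OF has_derivative_P_field[OF p Y' Q] u] D_along_eq[OF Y' u]
    by (subst dproj_expand[OF p u]) simp
qed

text \<open>Differentiate \<open>Y = P Y\<close>. Consequently the normal part of the derivative
  depends on \<open>Y\<close> only through \<open>Y p\<close>, which makes the second fundamental
  form a tensor.\<close>

lemma D_along_tangent_field:
  assumes p: "p \<in> M" and u: "u \<in> T p" and Y: "Y differentiable (at p within M)"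
    and W: "open W" "p \<in> W" and YT: "\<And>x. x \<in> M \<Longrightarrow> x \<in> W \<Longrightarrow> Y x \<in> T x"
  shows "D_along M Y p u = P p (D_along M Y p u) + dproj M p u (Y p)"
proof -
  have "D_along M (\<lambda>x. P x (Y x)) p u = D_along M Y p u"
    by (rule D_along_cong[OF Y u p W]) (simp add: orth_proj_id subspace_T YT)
  then show ?thesis using D_along_P_field[OF p u Y] by simp
qed

text \<open>This is the derivative of the identity that \<open>P\<close> is idempotent, from the
  preceding lemma with the tangent field \<open>P x v\<close>.\<close>

lemma dproj_P:
  assumes p: "p \<in> M" and u: "u \<in> T p"
  shows "dproj M p u (P p v) = dproj M p u v - P p (dproj M p u v)"
proof -
  have "D_along M (\<lambda>x. P x v) p u = P p (D_along M (\<lambda>x. P x v) p u) + dproj M p u (P p v)"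
    by (rule D_along_tangent_field[OF p u differentiable_P[OF p] open_UNIV])
      (auto simp: orth_proj_mem subspace_T)
  then show ?thesis by (simp add: dproj_def eq_diff_eq add.commute)
qed

text \<open>All admissible extensions of \<open>v\<close> give the same value by
  \<open>D_along_tangent_field\<close>, since the projection kills the tangential part; the
  extension \<open>P x v\<close> shows that one exists. So the definite description is
  resolved.\<close>

lemma second_fundamental_form_eq:
  assumes p: "p \<in> M" and u: "u \<in> T p" and v: "v \<in> T p" and N: "subspace (normal_space N M p)"
  shows "second_fundamental_form N M p u v = orth_proj (normal_space N M p) (dproj M p u v)"
    (is "_ = ?rhs")
  unfolding second_fundamental_form_def
proof (rule the_equality)
  have perp: "orth_proj (normal_space N M p) t = 0" if "t \<in> T p" for t
    using that by (intro orth_proj_zero[OF N]) (auto simp: normal_space_def orthogonal_def inner_commute)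
  have val: "orth_proj (normal_space N M p) (D_along M Y p u) = ?rhs"
    if "open W" "p \<in> W" "C1_along (M \<inter> W) Y" "\<forall>x\<in>M \<inter> W. Y x \<in> T x" "Y p = v" for W Y
  proof -
    have "Y differentiable (at p within M \<inter> W)"
      by (rule C1_along_differentiable[OF that(3)]) (use p that in auto)
    moreover have "at p within M \<inter> W = at p within M"
      by (rule at_within_nhd[OF that(2,1)]) auto
    ultimately have "Y differentiable (at p within M)" by simp
    then have "D_along M Y p u = P p (D_along M Y p u) + dproj M p u v"
      using D_along_tangent_field[OF p u _ that(1,2)] that by auto
    then have "orth_proj (normal_space N M p) (D_along M Y p u)
        = orth_proj (normal_space N M p) (P p (D_along M Y p u) + dproj M p u v)" by simp
    also have "\<dots> = ?rhs"
      by (simp add: linear_add[OF linear_orth_proj[OF N]] perp orth_proj_mem subspace_T p)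
    finally show ?thesis .
  qed
  show "\<exists>W Y. open W \<and> p \<in> W \<and> C1_along (M \<inter> W) Y \<and> (\<forall>x\<in>M \<inter> W. Y x \<in> T x) \<and> Y p = v \<and>
      ?rhs = orth_proj (normal_space N M p) (D_along M Y p u)"
  proof (intro exI conjI)
    show "C1_along (M \<inter> UNIV) (\<lambda>x. P x v)" using C1_along_tangent_projection[OF C2] by simp
    show "\<forall>x\<in>M \<inter> UNIV. P x v \<in> T x" by (simp add: orth_proj_mem subspace_T)
    show "P p v = v" by (simp add: orth_proj_id subspace_T p v)
    show "?rhs = orth_proj (normal_space N M p) (D_along M (\<lambda>x. P x v) p u)"
      by (simp add: dproj_def)
  qed auto
  show "w = ?rhs" if "\<exists>W Y. open W \<and> p \<in> W \<and> C1_along (M \<inter> W) Y \<and> (\<forall>x\<in>M \<inter> W. Y x \<in> T x) \<and> Y p = v \<and>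
      w = orth_proj (normal_space N M p) (D_along M Y p u)" for w
    using that by (elim exE conjE) (simp add: val)
qed

section \<open>Orthonormal tangent frames and traces\<close>

lemma orthonormal_frame:
  assumes "p \<in> M"
  shows orthonormal_frame_subset: "orthonormal_frame M p \<subseteq> T p"
    and orthonormal_frame_inner: "e \<in> orthonormal_frame M p \<Longrightarrow> e' \<in> orthonormal_frame M p \<Longrightarrow>
        e \<bullet> e' = (if e = e' then 1 else 0)"
    and orthonormal_frame_span: "span (orthonormal_frame M p) = T p"
    and finite_orthonormal_frame: "finite (orthonormal_frame M p)"
    and card_orthonormal_frame: "card (orthonormal_frame M p) = k"
proof -
  obtain B where B: "B \<subseteq> T p" "pairwise orthogonal B" "\<And>x. x \<in> B \<Longrightarrow> norm x = 1" "span B = T p"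
    using orthonormal_basis_subspace[OF subspace_T[OF assms]] by metis
  let ?E = "orthonormal_frame M p"
  have E: "?E \<subseteq> T p \<and> pairwise orthogonal ?E \<and> (\<forall>e\<in>?E. norm e = 1) \<and> span ?E = T p"
    unfolding orthonormal_frame_def by (rule someI[of _ B]) (use B in auto)
  then show "?E \<subseteq> T p" "span ?E = T p" by auto
  show "e \<bullet> e' = (if e = e' then 1 else 0)" if "e \<in> ?E" "e' \<in> ?E"
    using E that by (auto simp: pairwise_def orthogonal_def norm_eq_1)
  have "0 \<notin> ?E" using E by auto
  then have ind: "independent ?E" using E pairwise_orthogonal_independent by blast
  then show "finite ?E" by (rule independent_imp_finite)
  show "card ?E = k" using E ind dim_tangent_space[OF C2 assms] dim_span_eq_card_independent by metis
qed

lemma P_frame: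
  assumes "p \<in> M"
  shows "P p v = (\<Sum>e\<in>orthonormal_frame M p. (v \<bullet> e) *\<^sub>R e)"
proof (rule orth_proj_unique[OF subspace_T[OF assms]])
  let ?E = "orthonormal_frame M p"
  have "(\<Sum>e\<in>?E. (v \<bullet> e) *\<^sub>R e) \<in> span ?E" by (intro span_sum span_scale span_base)
  then show "(\<Sum>e\<in>?E. (v \<bullet> e) *\<^sub>R e) \<in> T p" by (simp add: orthonormal_frame_span assms)
  fix z assume "z \<in> T p"
  then have "z \<in> span ?E" by (simp add: orthonormal_frame_span assms)
  moreover have "orthogonal (v - (\<Sum>e\<in>?E. (v \<bullet> e) *\<^sub>R e)) e'" if "e' \<in> ?E" for e'
  proof -
    have "(\<Sum>e\<in>?E. (v \<bullet> e) * (e \<bullet> e')) = (\<Sum>e\<in>?E. if e = e' then v \<bullet> e' else 0)"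
      using orthonormal_frame_inner[OF assms _ that] by (intro sum.cong) auto
    then show ?thesis using that finite_orthonormal_frame[OF assms]
      by (simp add: orthogonal_def inner_diff_left inner_sum_left)
  qed
  ultimately show "orthogonal (v - (\<Sum>e\<in>?E. (v \<bullet> e) *\<^sub>R e)) z"
    by (rule orthogonal_to_span[of z ?E])
qed

text \<open>The right-hand side no longer mentions the arbitrary choice of an orthonormal frame at each
  point, which makes its continuity in \<open>p\<close> evident.\<close>

lemma sum_frame_eq_sum_Basis:
  fixes L :: "'a \<Rightarrow> 'b::real_inner"
  assumes p: "p \<in> M" and L: "linear L"
  shows "(\<Sum>e\<in>orthonormal_frame M p. L e \<bullet> L e) = (\<Sum>c\<in>Basis. L (P p c) \<bullet> L (P p c))"
proof -
  let ?E = "orthonormal_frame M p"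
  have fin: "finite ?E" by (rule finite_orthonormal_frame[OF p])
  have parseval: "(\<Sum>c\<in>Basis. ((c \<bullet> e) * (c \<bullet> e')) * x) = (e \<bullet> e') * x" for e e' :: 'a and x :: real
    unfolding euclidean_inner[of e e'] sum_distrib_right by (simp add: inner_commute)
  have "L (P p c) \<bullet> L (P p c) = (\<Sum>e\<in>?E. \<Sum>e'\<in>?E. ((c \<bullet> e) * (c \<bullet> e')) * (L e \<bullet> L e'))" for c
    by (simp add: P_frame[OF p] linear_sum[OF L] linear_scale[OF L] inner_sum_left inner_sum_right
        sum_distrib_left mult.assoc mult.left_commute inner_commute)
  then have "(\<Sum>c\<in>Basis. L (P p c) \<bullet> L (P p c))
      = (\<Sum>c\<in>Basis. \<Sum>e\<in>?E. \<Sum>e'\<in>?E. ((c \<bullet> e) * (c \<bullet> e')) * (L e \<bullet> L e'))" by simp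
  also have "\<dots> = (\<Sum>e\<in>?E. \<Sum>e'\<in>?E. \<Sum>c\<in>Basis. ((c \<bullet> e) * (c \<bullet> e')) * (L e \<bullet> L e'))"
    by (subst sum.swap) (intro sum.cong refl sum.swap)
  also have "\<dots> = (\<Sum>e\<in>?E. \<Sum>e'\<in>?E. (e \<bullet> e') * (L e \<bullet> L e'))"
    by (intro sum.cong refl parseval)
  also have "\<dots> = (\<Sum>e\<in>?E. L e \<bullet> L e)"
    using fin by (intro sum.cong refl)
      (simp add: orthonormal_frame_inner[OF p] if_distrib[of "\<lambda>x. x * _"] cong: if_cong)
  finally show ?thesis by simp
qed

end

section \<open>Submanifolds of the sphere\<close>

lemma tangent_space_UNIV: "tangent_space UNIV p = UNIV"
proof -
  have "v \<in> tangent_space UNIV p" for v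
  proof (rule tangent_spaceI[of 1 "\<lambda>t. p + t *\<^sub>R v"])
    show "C1_on (\<lambda>t. p + t *\<^sub>R v) {-1<..<1}"
      by (intro C1_on_add C1_on_const C1_on_scaleR C1_on_bounded_linear bounded_linear_ident)
    show "((\<lambda>t. p + t *\<^sub>R v) has_vector_derivative v) (at 0)"
      by (auto intro!: derivative_eq_intros)
  qed auto
  then show ?thesis by blast
qed

text \<open>Differentiate the constant function \<open>\<gamma> t \<bullet> \<gamma> t\<close> at
  0.\<close>

lemma tangent_space_sphere_subset:
  assumes "v \<in> tangent_space (sphere 0 R) p"
  shows "v \<bullet> p = 0"
proof -
  obtain \<gamma> \<epsilon> where \<gamma>: "0 < \<epsilon>" "C1_on \<gamma> {-\<epsilon><..<\<epsilon>}" "\<gamma> ` {-\<epsilon><..<\<epsilon>} \<subseteq> sphere 0 R" "\<gamma> 0 = p"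
      "(\<gamma> has_vector_derivative v) (at 0)"
    using assms by (rule tangent_spaceE)
  have "((\<lambda>t. \<gamma> t \<bullet> \<gamma> t) has_derivative (\<lambda>t. \<gamma> 0 \<bullet> (t *\<^sub>R v) + (t *\<^sub>R v) \<bullet> \<gamma> 0)) (at 0)"
    using \<gamma>(5) unfolding has_vector_derivative_def by (intro has_derivative_inner)
  then have "((\<lambda>t::real. R\<^sup>2) has_derivative (\<lambda>t. \<gamma> 0 \<bullet> (t *\<^sub>R v) + (t *\<^sub>R v) \<bullet> \<gamma> 0)) (at 0)"
  proof (rule has_derivative_transform_within_open[where s="{-\<epsilon><..<\<epsilon>}"])
    fix t assume "t \<in> {-\<epsilon><..<\<epsilon>}"
    then have "\<gamma> t \<in> sphere 0 R" using \<gamma>(3) by blast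
    then show "\<gamma> t \<bullet> \<gamma> t = R\<^sup>2" by (simp add: dot_square_norm)
  qed (use \<gamma>(1) in auto)
  then have "(\<lambda>t. \<gamma> 0 \<bullet> (t *\<^sub>R v) + (t *\<^sub>R v) \<bullet> \<gamma> 0) = (\<lambda>t::real. 0)"
    by (rule has_derivative_unique) (rule has_derivative_const)
  from fun_cong[OF this, of 1] show ?thesis by (simp add: \<gamma>(4) inner_commute)
qed

text \<open>Tangent vectors of the sphere are the velocities of great circles.\<close>

lemma tangent_space_sphere:
  fixes p :: "'a::euclidean_space"
  assumes p: "p \<in> sphere 0 R" and R: "0 < R"
  shows "tangent_space (sphere 0 R) p = {v. v \<bullet> p = 0}"
proof
  show "{v. v \<bullet> p = 0} \<subseteq> tangent_space (sphere 0 R) p"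
  proof clarify
    fix v :: 'a assume v: "v \<bullet> p = 0"
    show "v \<in> tangent_space (sphere 0 R) p"
    proof (cases "v = 0")
      case True
      show ?thesis
        by (rule tangent_spaceI[of 1 "\<lambda>_. p"]) (use p True in \<open>auto intro: C1_on_const derivative_eq_intros\<close>)
    next
      case False
      \<comment> \<open>The angular speed of the great circle: it makes \<open>v / a\<close> a
        vector of length \<open>R\<close>, like \<open>p\<close>, while the velocity at 0 is
        \<open>v\<close>.\<close>
      define a where "a = norm v / R"
      have a: "0 < a" using False R by (simp add: a_def)
      define \<gamma> where "\<gamma> t = cos (a * t) *\<^sub>R p + (sin (a * t) / a) *\<^sub>R v" for t
      have pp: "p \<bullet> p = R\<^sup>2" using p by (simp add: dot_square_norm)
      have vv: "v \<bullet> v = a\<^sup>2 * R\<^sup>2" using R by (simp add: a_def power_divide dot_square_norm)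
      have "\<gamma> t \<bullet> \<gamma> t = (cos (a * t))\<^sup>2 * R\<^sup>2 + (sin (a * t))\<^sup>2 * R\<^sup>2" for t
        using a v by (simp add: \<gamma>_def inner_add_left inner_add_right pp vv inner_commute[of p v] power2_eq_square)
      then have "\<gamma> t \<bullet> \<gamma> t = R\<^sup>2" for t
        by (metis distrib_right mult_1 sin_cos_squared_add2)
      then have sph: "\<gamma> t \<in> sphere 0 R" for t
        using R by (simp add: norm_eq_sqrt_inner real_sqrt_abs abs_of_pos)
      have der: "(\<gamma> has_derivative (\<lambda>h. h *\<^sub>R (cos (a * t) *\<^sub>R v - (a * sin (a * t)) *\<^sub>R p))) (at t)" for t
        unfolding \<gamma>_def using a
        by (auto intro!: derivative_eq_intros simp: fun_eq_iff algebra_simps)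
      show ?thesis
      proof (rule tangent_spaceI[of 1 \<gamma>])
        show "C1_on \<gamma> {-1<..<1}"
          by (rule C1_onI[OF der]) (intro continuous_intros)
        show "(\<gamma> has_vector_derivative v) (at 0)"
          using der[of 0] by (simp add: has_vector_derivative_def)
      qed (use sph in \<open>auto simp: \<gamma>_def\<close>)
    qed
  qed
qed (use tangent_space_sphere_subset in blast)

lemma normal_space_UNIV: "normal_space UNIV M p = {v. \<forall>w\<in>tangent_space M p. v \<bullet> w = 0}"
  by (simp add: normal_space_def tangent_space_UNIV orthogonal_def)

locale sphere_submanifold = C2_manifold k M for k and M :: "'a::euclidean_space set" +
  fixes R :: real
  assumes R: "0 < R" and M_sphere: "M \<subseteq> sphere 0 R"
begin

abbreviation "NU p \<equiv> normal_space UNIV M p"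
abbreviation "NS p \<equiv> normal_space (sphere 0 R) M p"

text \<open>Simons' test fields: the normal parts in the sphere of the constant fields \<open>v\<close>.\<close>

definition X :: "'a \<Rightarrow> 'a \<Rightarrow> 'a" where
  "X v p = v - P p v - ((v \<bullet> p) / R\<^sup>2) *\<^sub>R p"

lemma inner_self: "p \<in> M \<Longrightarrow> p \<bullet> p = R\<^sup>2"
  using M_sphere by (auto simp: dot_square_norm)

lemma norm_M: "p \<in> M \<Longrightarrow> norm p = R"
  using M_sphere by auto

lemma tangent_orthogonal: "u \<in> T p \<Longrightarrow> u \<bullet> p = 0"
  using tangent_space_mono[OF M_sphere] tangent_space_sphere_subset by blast

lemma normal_space_sphere: "p \<in> M \<Longrightarrow> NS p = {v. v \<bullet> p = 0 \<and> (\<forall>w\<in>T p. v \<bullet> w = 0)}"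
  using M_sphere R by (auto simp: normal_space_def tangent_space_sphere orthogonal_def)

lemma subspace_NU: "subspace (NU p)"
  by (auto simp: normal_space_UNIV subspace_def inner_add_left)

lemma subspace_NS: "p \<in> M \<Longrightarrow> subspace (NS p)"
  by (auto simp: normal_space_sphere subspace_def inner_add_left)

lemma P_inner_p: "p \<in> M \<Longrightarrow> P p v \<bullet> p = 0"
  by (rule tangent_orthogonal[OF orth_proj_mem[OF subspace_T]])

lemma orth_proj_NU:
  assumes p: "p \<in> M"
  shows "orth_proj (NU p) y = y - P p y"
proof (rule orth_proj_unique[OF subspace_NU])
  show "y - P p y \<in> NU p"
    unfolding normal_space_UNIV using orth_proj_orthogonal[OF subspace_T[OF p]] by blast
  show "orthogonal (y - (y - P p y)) z" if "z \<in> NU p" for z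
  proof -
    have "z \<bullet> P p y = 0"
      using that orth_proj_mem[OF subspace_T[OF p], of y] by (simp add: normal_space_UNIV)
    then show ?thesis by (simp add: orthogonal_def inner_commute)
  qed
qed

text \<open>\<open>T p\<close> is orthogonal to \<open>p\<close>, so subtracting both components is
  one orthogonal projection. In particular \<open>X\<close> is self-adjoint in its vector argument,
  which \<open>X_inner_X\<close> records.\<close>

lemma orth_proj_NS:
  assumes p: "p \<in> M"
  shows "orth_proj (NS p) y = X y p"
proof (rule orth_proj_unique[OF subspace_NS[OF p]])
  have "X y p \<bullet> p = 0"
    using R by (simp add: X_def inner_diff_left P_inner_p[OF p] inner_self[OF p])
  moreover have "X y p \<bullet> w = 0" if "w \<in> T p" for w
  proof -
    have "p \<bullet> w = 0" using tangent_orthogonal[OF that] by (simp add: inner_commute)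
    then show ?thesis
      using orth_proj_orthogonal[OF subspace_T[OF p] that, of y] by (simp add: X_def inner_diff_left)
  qed
  ultimately show "X y p \<in> NS p" by (simp add: normal_space_sphere[OF p])
  show "orthogonal (y - X y p) z" if "z \<in> NS p" for z
  proof -
    have "z \<bullet> P p y = 0" "z \<bullet> p = 0"
      using that orth_proj_mem[OF subspace_T[OF p], of y] by (simp_all add: normal_space_sphere[OF p])
    then show ?thesis by (simp add: X_def orthogonal_def inner_add_right inner_commute[of _ z])
  qed
qed

text \<open>Differentiate \<open>P x v \<bullet> x = 0\<close> along \<open>M\<close>. This radial
  part is the contribution of the curvature of the sphere itself.\<close>

lemma dproj_inner_p:
  assumes p: "p \<in> M" and u: "u \<in> T p" and v: "v \<in> T p"
  shows "dproj M p u v \<bullet> p = - (u \<bullet> v)"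
proof -
  obtain Q where Q: "((\<lambda>x. P x v) has_derivative Q) (at p within M)"
    using differentiable_P[OF p, of v] unfolding differentiable_def by blast
  have "((\<lambda>x. P x v \<bullet> x) has_derivative (\<lambda>u. P p v \<bullet> u + Q u \<bullet> p)) (at p within M)"
    by (intro has_derivative_inner Q has_derivative_ident)
  moreover have "((\<lambda>x. P x v \<bullet> x) has_derivative (\<lambda>u. 0)) (at p within M)"
    by (rule has_derivative_transform[OF p _ has_derivative_const[of 0]]) (simp add: P_inner_p)
  ultimately have "P p v \<bullet> u + Q u \<bullet> p = 0"
    by (rule has_derivative_within_unique_tangent) (rule u)
  moreover have "dproj M p u v = Q u" unfolding dproj_def by (rule D_along_eq[OF Q u])
  ultimately show ?thesis using v by (simp add: orth_proj_id subspace_T p inner_commute)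
qed

lemma P_dproj_zero:
  assumes "p \<in> M" "u \<in> T p" "v \<in> T p"
  shows "P p (dproj M p u v) = 0"
  using dproj_P[OF assms(1,2), of v] assms by (simp add: orth_proj_id subspace_T)

lemma sff_UNIV:
  assumes "p \<in> M" "u \<in> T p" "v \<in> T p"
  shows "second_fundamental_form UNIV M p u v = dproj M p u v"
  using assms by (simp add: second_fundamental_form_eq subspace_NU orth_proj_NU P_dproj_zero)

lemma sff_sphere:
  assumes "p \<in> M" "u \<in> T p" "v \<in> T p"
  shows "second_fundamental_form (sphere 0 R) M p u v = dproj M p u v + ((u \<bullet> v) / R\<^sup>2) *\<^sub>R p"
  using assms by (simp add: second_fundamental_form_eq subspace_NS orth_proj_NS X_def P_dproj_zero dproj_inner_p)

lemma frame_T: "p \<in> M \<Longrightarrow> e \<in> orthonormal_frame M p \<Longrightarrow> e \<in> T p"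
  using orthonormal_frame_subset by blast

text \<open>By \<open>sff_sphere\<close> the two second fundamental forms differ by a radial vector,
  and each of the \<open>k\<close> frame vectors contributes \<open>p / R^2\<close> to the
  trace.\<close>

lemma mean_curvature_UNIV:
  assumes p: "p \<in> M" and min: "mean_curvature (sphere 0 R) M p = 0"
  shows "mean_curvature UNIV M p = - (real k / R\<^sup>2) *\<^sub>R p"
proof -
  let ?E = "orthonormal_frame M p"
  have "0 = (\<Sum>e\<in>?E. dproj M p e e + (1 / R\<^sup>2) *\<^sub>R p)"
    using min p by (simp add: mean_curvature_def sff_sphere frame_T orthonormal_frame_inner cong: sum.cong)
  then have "(\<Sum>e\<in>?E. dproj M p e e) = - (real k / R\<^sup>2) *\<^sub>R p"
    by (simp add: sum.distrib card_orthonormal_frame[OF p] sum_constant_scaleR eq_neg_iff_add_eq_0)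
  then show ?thesis by (simp add: mean_curvature_def sff_UNIV frame_T p cong: sum.cong)
qed

lemma C1_along_X: "C1_along M (X v)"
proof (rule C1_alongI)
  fix p assume p: "p \<in> M"
  obtain W Y where Y: "open W" "p \<in> W" "C1_on Y W" "\<And>x. x \<in> M \<Longrightarrow> x \<in> W \<Longrightarrow> Y x = P x v"
    using C1_alongE[OF C1_along_tangent_projection[OF C2] p] by blast
  have "C1_on (\<lambda>x. v - Y x - ((v \<bullet> x) * (1 / R\<^sup>2)) *\<^sub>R x) W"
    by (intro C1_on_diff C1_on_scaleR C1_on_const Y C1_on_bounded_linear bounded_linear_ident
        bounded_linear_intros)
  then have "open W \<and> p \<in> W \<and> C1_on (\<lambda>x. v - Y x - ((v \<bullet> x) * (1 / R\<^sup>2)) *\<^sub>R x) W \<and>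
      (\<forall>x\<in>M \<inter> W. v - Y x - ((v \<bullet> x) * (1 / R\<^sup>2)) *\<^sub>R x = X v x)"
    using Y by (simp add: X_def)
  then show "\<exists>W Y. open W \<and> p \<in> W \<and> C1_on Y W \<and> (\<forall>x\<in>M \<inter> W. Y x = X v x)" by blast
qed

lemma D_along_X:
  assumes p: "p \<in> M" and u: "u \<in> T p"
  shows "D_along M (X v) p u = - dproj M p u v - ((v \<bullet> u) / R\<^sup>2) *\<^sub>R p - ((v \<bullet> p) / R\<^sup>2) *\<^sub>R u"
proof -
  obtain Q where Q: "((\<lambda>x. P x v) has_derivative Q) (at p within M)"
    using differentiable_P[OF p, of v] unfolding differentiable_def by blast
  have "(X v has_derivative (\<lambda>u. 0 - Q u - (((v \<bullet> p) / R\<^sup>2) *\<^sub>R u + ((v \<bullet> u) / R\<^sup>2) *\<^sub>R p))) (at p within M)"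
  proof -
    have "X v = (\<lambda>x. v - P x v - (1 / R\<^sup>2) *\<^sub>R ((v \<bullet> x) *\<^sub>R x))"
      by (simp add: X_def fun_eq_iff)
    moreover have "((\<lambda>x. v - P x v - (1 / R\<^sup>2) *\<^sub>R ((v \<bullet> x) *\<^sub>R x)) has_derivative
        (\<lambda>u. 0 - Q u - (1 / R\<^sup>2) *\<^sub>R ((v \<bullet> p) *\<^sub>R u + (v \<bullet> u) *\<^sub>R p))) (at p within M)"
      by (intro has_derivative_diff has_derivative_const Q has_derivative_scaleR_right
          has_derivative_scaleR has_derivative_ident has_derivative_inner_right)
    ultimately show ?thesis by (simp add: scaleR_add_right)
  qed
  then have "D_along M (X v) p u = 0 - Q u - (((v \<bullet> p) / R\<^sup>2) *\<^sub>R u + ((v \<bullet> u) / R\<^sup>2) *\<^sub>R p)"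
    by (rule D_along_eq[OF _ u])
  moreover have "dproj M p u v = Q u" unfolding dproj_def by (rule D_along_eq[OF Q u])
  ultimately show ?thesis by (simp add: algebra_simps)
qed

lemma X_NS: "p \<in> M \<Longrightarrow> X v p \<in> NS p"
  using orth_proj_mem[OF subspace_NS, of p v] by (simp add: orth_proj_NS)

lemma X_inner_p: "p \<in> M \<Longrightarrow> X v p \<bullet> p = 0"
  using X_NS[of p v] by (simp add: normal_space_sphere)

lemma X_inner_T: "p \<in> M \<Longrightarrow> w \<in> T p \<Longrightarrow> X v p \<bullet> w = 0"
  using X_NS[of p v] by (simp add: normal_space_sphere)

lemma inner_X_X: "p \<in> M \<Longrightarrow> X d p \<bullet> X v p = d \<bullet> X v p"
  using orth_proj_inner[OF subspace_NS X_NS, of p d v] by (simp add: orth_proj_NS)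

lemma X_inner_X: "p \<in> M \<Longrightarrow> X v p \<bullet> d = v \<bullet> X d p"
  using inner_X_X[of p d v] inner_X_X[of p v d] by (simp add: inner_commute)

lemma norm_X: "p \<in> M \<Longrightarrow> (norm (X v p))\<^sup>2 = v \<bullet> X v p"
  by (simp add: power2_norm_eq_inner inner_X_X)

text \<open>Removing tangential parts deletes the multiple of \<open>u\<close> in
  \<open>D_along_X\<close> and, by \<open>dproj_P\<close>, turns \<open>v\<close> into
  \<open>P p v\<close> inside \<open>dproj\<close>. The radial term left over is the one that
  \<open>X\<close> takes away, by \<open>dproj_inner_p\<close>.\<close>

lemma orth_proj_D_along_X:
  assumes p: "p \<in> M" and u: "u \<in> T p"
  shows "orth_proj (NU p) (D_along M (X v) p u) = - X (dproj M p u (P p v)) p"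
proof -
  have PT: "P p v \<in> T p" by (rule orth_proj_mem[OF subspace_T[OF p]])
  have lin: "linear (P p)" by (rule linear_orth_proj[OF subspace_T[OF p]])
  have "P p p = 0"
    using tangent_orthogonal by (intro orth_proj_zero subspace_T p) (simp add: inner_commute)
  moreover have "P p u = u" by (simp add: orth_proj_id subspace_T p u)
  moreover have "u \<bullet> P p v = v \<bullet> u"
    using orth_proj_inner[OF subspace_T[OF p] u, of v] by (simp add: inner_commute)
  moreover from this have "X (dproj M p u (P p v)) p = dproj M p u (P p v) + ((v \<bullet> u) / R\<^sup>2) *\<^sub>R p"
    by (simp add: X_def P_dproj_zero[OF p u PT] dproj_inner_p[OF p u PT])
  ultimately show ?thesis
    by (simp add: D_along_X p u orth_proj_NU linear_diff[OF lin] linear_neg[OF lin]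
        linear_scale[OF lin] dproj_P)
qed

text \<open>Up to the factor \<open>R powi (- k)\<close>, the curvature and the gradient term of \<open>X v\<close> are the
  sums of \<open>G d v\<close> and of \<open>G v d\<close> over an orthonormal basis of vectors \<open>d\<close>, so that they cancel
  when summed over \<open>v\<close>.\<close>

definition G :: "'a \<Rightarrow> 'a \<Rightarrow> 'a \<Rightarrow> real" where
  "G d v p = (\<Sum>c\<in>Basis. (dproj M p (P p c) d \<bullet> X v p)\<^sup>2)"

lemma G_frame:
  assumes p: "p \<in> M"
  shows "G d v p = (\<Sum>e\<in>orthonormal_frame M p. (dproj M p e d \<bullet> X v p)\<^sup>2)"
proof -
  \<comment> \<open>Inserting \<open>P p\<close> makes the map linear on the whole space, as the
    change from frame to \<open>Basis\<close> requires, without altering it on tangent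
    vectors.\<close>
  define L where "L = (\<lambda>u. dproj M p (P p u) d \<bullet> X v p)"
  have "linear L"
    unfolding L_def dproj_def
    using linear_compose[OF D_along_linear[OF differentiable_P[OF p] subspace_T[OF p]]
        bounded_linear.linear[OF bounded_linear_inner_left]]
    by (simp add: comp_def)
  have id: "P p u = u" if "u \<in> T p" for u using that by (simp add: orth_proj_id subspace_T p)
  have "L e = dproj M p e d \<bullet> X v p" if "e \<in> orthonormal_frame M p" for e
    using that by (simp add: L_def id frame_T[OF p])
  moreover have "L (P p c) = dproj M p (P p c) d \<bullet> X v p" for c
    by (simp add: L_def id orth_proj_mem subspace_T p)
  ultimately show ?thesis
    using sum_frame_eq_sum_Basis[OF p \<open>linear L\<close>]
    by (simp add: G_def power2_eq_square cong: sum.cong)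
qed

lemma continuous_on_X: "continuous_on M (X v)"
  by (rule C1_along_continuous[OF C1_along_X])

lemma continuous_on_G: "continuous_on M (G d v)"
  unfolding G_def dproj_def
  by (intro continuous_intros continuous_on_X continuous_on_D_along C1_along_tangent_projection[OF C2]
      C1_along_continuous orth_proj_mem subspace_T)

text \<open>The two vectors paired with \<open>X v p\<close> differ by a tangent vector. This lets
  the second slot of \<open>dproj\<close> range over all of \<open>Basis\<close> instead of a
  tangent frame.\<close>

lemma dproj_inner_X:
  assumes p: "p \<in> M" and u: "u \<in> T p"
  shows "dproj M p u (P p d) \<bullet> X v p = dproj M p u d \<bullet> X v p"
  using X_inner_T[OF p orth_proj_mem[OF subspace_T[OF p]], of v "dproj M p u d"] p u
  by (simp add: dproj_P inner_diff_left inner_commute[of "P p (dproj M p u d)"])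

text \<open>The mean curvature vector is radial and drops out. The frame sum in the second slot
  becomes a sum over \<open>Basis\<close> of values at \<open>P p d\<close>, where
  \<open>dproj_inner_X\<close> replaces \<open>P p d\<close> by \<open>d\<close>.\<close>

lemma curvature_term:
  assumes p: "p \<in> M" and min: "mean_curvature (sphere 0 R) M p = 0"
  shows "(\<Sum>u\<in>orthonormal_frame M p. \<Sum>w\<in>orthonormal_frame M p.
        (second_fundamental_form UNIV M p u w \<bullet> X v p)\<^sup>2) + (mean_curvature UNIV M p \<bullet> X v p)\<^sup>2
      = (\<Sum>d\<in>Basis. G d v p)"
proof -
  let ?E = "orthonormal_frame M p"
  have "(\<Sum>w\<in>?E. (second_fundamental_form UNIV M p u w \<bullet> X v p)\<^sup>2)
      = (\<Sum>d\<in>Basis. (dproj M p u d \<bullet> X v p)\<^sup>2)" if "u \<in> ?E" for u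
  proof -
    have u: "u \<in> T p" using that by (rule frame_T[OF p])
    have lin: "linear (\<lambda>w. dproj M p u w \<bullet> X v p)"
      using linear_compose[OF linear_dproj[OF p u] bounded_linear.linear[OF bounded_linear_inner_left]]
      by (simp add: comp_def)
    show ?thesis
      using sum_frame_eq_sum_Basis[OF p lin] dproj_inner_X[OF p u] u
      by (simp add: sff_UNIV p frame_T power2_eq_square cong: sum.cong)
  qed
  then have "(\<Sum>u\<in>?E. \<Sum>w\<in>?E. (second_fundamental_form UNIV M p u w \<bullet> X v p)\<^sup>2)
      = (\<Sum>u\<in>?E. \<Sum>d\<in>Basis. (dproj M p u d \<bullet> X v p)\<^sup>2)" by simp
  also have "\<dots> = (\<Sum>d\<in>Basis. G d v p)" unfolding G_frame[OF p] by (rule sum.swap)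
  finally show ?thesis
    using X_inner_p[OF p, of v] by (simp add: mean_curvature_UNIV[OF p min] inner_commute)
qed

text \<open>Expand the squared norm in \<open>Basis\<close> and move \<open>X\<close> onto the basis
  vector \<open>d\<close> by self-adjointness. Now \<open>v\<close> sits inside \<open>dproj\<close>
  and \<open>d\<close> inside \<open>X\<close>, the reverse of the curvature term.\<close>

lemma gradient_term:
  assumes p: "p \<in> M"
  shows "(\<Sum>u\<in>orthonormal_frame M p. (norm (orth_proj (NU p) (D_along M (X v) p u)))\<^sup>2)
      = (\<Sum>d\<in>Basis. G v d p)"
proof -
  let ?E = "orthonormal_frame M p"
  have "(norm (orth_proj (NU p) (D_along M (X v) p u)))\<^sup>2
      = (\<Sum>d\<in>Basis. (dproj M p u v \<bullet> X d p)\<^sup>2)" if "u \<in> ?E" for u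
  proof -
    have u: "u \<in> T p" using that by (rule frame_T[OF p])
    have "(norm (orth_proj (NU p) (D_along M (X v) p u)))\<^sup>2 = (norm (X (dproj M p u (P p v)) p))\<^sup>2"
      by (simp add: orth_proj_D_along_X[OF p u])
    also have "\<dots> = (\<Sum>d\<in>Basis. (X (dproj M p u (P p v)) p \<bullet> d)\<^sup>2)"
      unfolding power2_norm_eq_inner by (subst euclidean_inner) (simp add: power2_eq_square)
    also have "\<dots> = (\<Sum>d\<in>Basis. (dproj M p u v \<bullet> X d p)\<^sup>2)"
      by (simp add: X_inner_X[OF p] dproj_inner_X[OF p u])
    finally show ?thesis .
  qed
  then have "(\<Sum>u\<in>?E. (norm (orth_proj (NU p) (D_along M (X v) p u)))\<^sup>2)
      = (\<Sum>u\<in>?E. \<Sum>d\<in>Basis. (dproj M p u v \<bullet> X d p)\<^sup>2)" by simp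
  also have "\<dots> = (\<Sum>d\<in>Basis. G v d p)" unfolding G_frame[OF p] by (rule sum.swap)
  finally show ?thesis .
qed

text \<open>The trace of the projection onto the normal space in the sphere: the identity minus a
  projection of rank \<open>k\<close> and the radial one of rank 1.\<close>

lemma sum_norm_X:
  assumes p: "p \<in> M"
  shows "(\<Sum>v\<in>Basis. (norm (X v p))\<^sup>2) = real DIM('a) - real k - 1"
proof -
  have "(\<Sum>v\<in>Basis. P p v \<bullet> P p v) = (\<Sum>e\<in>orthonormal_frame M p. e \<bullet> e)"
    using sum_frame_eq_sum_Basis[OF p linear_ident] by simp
  also have "\<dots> = real k" using p by (simp add: orthonormal_frame_inner card_orthonormal_frame)
  finally have k: "(\<Sum>v\<in>Basis. P p v \<bullet> P p v) = real k" .
  have "(norm (X v p))\<^sup>2 = v \<bullet> v - P p v \<bullet> P p v - (p \<bullet> v) * (p \<bullet> v) / R\<^sup>2" for v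
    using orth_proj_inner[OF subspace_T[OF p] orth_proj_mem[OF subspace_T[OF p]], of v v]
    by (simp add: norm_X[OF p]) (simp add: X_def inner_diff_right inner_commute)
  then have "(\<Sum>v\<in>Basis. (norm (X v p))\<^sup>2)
      = (\<Sum>v\<in>(Basis :: 'a set). v \<bullet> v) - real k - (p \<bullet> p) / R\<^sup>2"
    by (simp add: sum_subtractf k sum_divide_distrib[symmetric] euclidean_inner[of p p])
  then show ?thesis using R by (simp add: inner_self[OF p] inner_same_Basis)
qed

end

section \<open>Instability\<close>

lemma GDERIV_unique:
  assumes "GDERIV f x :> a" "GDERIV f x :> b"
  shows "a = b"
proof -
  have "(\<lambda>h. h \<bullet> a) = (\<lambda>h. h \<bullet> b)"
    using assms unfolding gderiv_def by (rule has_derivative_unique)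
  then show ?thesis by (metis vector_eq_ldot)
qed

lemma GDERIV_norm_powi:
  fixes x :: "'a::euclidean_space"
  assumes "x \<noteq> 0"
  shows "GDERIV (\<lambda>x. norm x powi n) x :> (of_int n * norm x powi (n - 2)) *\<^sub>R x"
proof -
  have "norm x powi (n - 1 - 1) = norm x powi (n - 1) / norm x"
    using assms by (subst power_int_diff) simp_all
  then have pw: "norm x powi (n - 1) / norm x = norm x powi (n - 2)" by simp
  have "((\<lambda>x. norm x powi n) has_derivative (\<lambda>h. (h \<bullet> sgn x) * (of_int n * norm x powi (n - 1)))) (at x)"
    using GDERIV_norm[OF assms] assms unfolding gderiv_def by (intro has_derivative_power_int) auto
  moreover have "(h \<bullet> sgn x) * (of_int n * norm x powi (n - 1)) = h \<bullet> (of_int n * norm x powi (n - 2)) *\<^sub>R x" for h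
    unfolding pw[symmetric] by (simp add: sgn_div_norm divide_inverse)
  ultimately show ?thesis by (simp add: gderiv_def)
qed

lemma grad_norm_powi:
  fixes x :: "'a::euclidean_space"
  assumes "x \<noteq> 0"
  shows "grad (\<lambda>x. norm x powi n) x = (of_int n * norm x powi (n - 2)) *\<^sub>R x"
  unfolding grad_def
proof (rule the_equality)
  show der: "GDERIV (\<lambda>x. norm x powi n) x :> (of_int n * norm x powi (n - 2)) *\<^sub>R x"
    by (rule GDERIV_norm_powi[OF assms])
  show "g = (of_int n * norm x powi (n - 2)) *\<^sub>R x" if "GDERIV (\<lambda>x. norm x powi n) x :> g" for g
    by (rule GDERIV_unique[OF that der])
qed

text \<open>The Hessian is a multiple of the identity plus a rank-one radial term, and the latter
  vanishes on \<open>u\<close>.\<close>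

lemma hess_norm_powi:
  fixes x :: "'a::euclidean_space"
  assumes "x \<noteq> 0" and "u \<bullet> x = 0"
  shows "hess (\<lambda>x. norm x powi n) x u u = of_int n * norm x powi (n - 2) * (norm u)\<^sup>2"
proof -
  let ?c = "of_int (n - 2) * norm x powi (n - 2 - 2) :: real"
  have "((\<lambda>y. norm y powi (n - 2)) has_derivative (\<lambda>h. h \<bullet> ?c *\<^sub>R x)) (at x)"
    using GDERIV_norm_powi[OF assms(1), of "n - 2"] by (simp add: gderiv_def)
  then have "((\<lambda>y. (of_int n * norm y powi (n - 2)) *\<^sub>R y) has_derivative
      (\<lambda>h. (of_int n * norm x powi (n - 2)) *\<^sub>R h + (of_int n * (h \<bullet> ?c *\<^sub>R x)) *\<^sub>R x)) (at x)"
    by (intro has_derivative_scaleR has_derivative_mult_right has_derivative_ident)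
  then have "(grad (\<lambda>x. norm x powi n) has_derivative
      (\<lambda>h. (of_int n * norm x powi (n - 2)) *\<^sub>R h + (of_int n * (h \<bullet> ?c *\<^sub>R x)) *\<^sub>R x)) (at x)"
    by (rule has_derivative_transform_within_open[of _ _ _ _ "- {0}"])
      (use assms(1) in \<open>auto simp: grad_norm_powi\<close>)
  from frechet_derivative_at[OF this, symmetric] show ?thesis
    using assms(2) by (simp add: hess_def power2_norm_eq_inner inner_commute[of x u])
qed

section \<open>Compact submanifolds have positive and finite Hausdorff measure\<close>

context metric_outer_measure
begin

lemma finite_UN_less_top:
  assumes "finite I" "\<And>i. i \<in> I \<Longrightarrow> \<mu> (A i) < top"
  shows "\<mu> (\<Union>i\<in>I. A i) < top"
  using assms
proof (induction I rule: finite_induct)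
  case empty
  then show ?case by (simp add: outer_empty)
next
  case (insert i I)
  have "\<mu> (\<Union>i\<in>insert i I. A i) \<le> \<mu> (A i) + \<mu> (\<Union>i\<in>I. A i)"
    using Un_le[of "A i" "\<Union>i\<in>I. A i"] by simp
  also have "\<dots> < top" using insert by simp
  finally show ?case .
qed

end

context C2_manifold
begin

text \<open>Near \<open>p\<close> the set \<open>M\<close> is contained in the image of a bounded
  piece of \<open>S\<close> under \<open>\<psi>\<close>, which is Lipschitz there.\<close>

lemma hausdorff_outer_locally_finite:
  assumes "p \<in> M"
  obtains W where "open W" "p \<in> W" "hausdorff_outer k (M \<inter> W) < top"
proof -
  obtain W V \<phi> \<psi> S where ch: "submanifold_chart k M W V \<phi> \<psi> S" and p: "p \<in> W"
    using C2_submanifold_chart[OF C2 assms] by blast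
  interpret submanifold_chart k M W V \<phi> \<psi> S by (rule ch)
  obtain r L where r: "0 < r" "ball (\<phi> p) r \<subseteq> V" "L-lipschitz_on (ball (\<phi> p) r) \<psi>"
    using C1_on_locally_lipschitz[OF C2_on_imp_C1_on[OF C2_\<psi>] open_V \<phi>_V[OF p]] by blast
  have "open (W \<inter> \<phi> -` ball (\<phi> p) r)"
    using C1_on_continuous[OF C2_on_imp_C1_on[OF C2_\<phi>]] open_W
    by (intro continuous_open_preimage) auto
  moreover have "p \<in> W \<inter> \<phi> -` ball (\<phi> p) r" using p r(1) by simp
  moreover have "hausdorff_outer k (M \<inter> (W \<inter> \<phi> -` ball (\<phi> p) r)) < top"
  proof (rule le_less_trans)
    have "M \<inter> (W \<inter> \<phi> -` ball (\<phi> p) r) \<subseteq> \<psi> ` (S \<inter> ball (\<phi> p) r)"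
    proof
      fix x assume "x \<in> M \<inter> (W \<inter> \<phi> -` ball (\<phi> p) r)"
      then have "x = \<psi> (\<phi> x)" "\<phi> x \<in> S \<inter> ball (\<phi> p) r" by (simp_all add: \<psi>_\<phi> \<phi>_S)
      then show "x \<in> \<psi> ` (S \<inter> ball (\<phi> p) r)" by (rule image_eqI)
    qed
    then show "hausdorff_outer k (M \<inter> (W \<inter> \<phi> -` ball (\<phi> p) r))
        \<le> hausdorff_outer k (\<psi> ` (S \<inter> ball (\<phi> p) r))" by (rule hausdorff.mono)
    show "hausdorff_outer k (\<psi> ` (S \<inter> ball (\<phi> p) r)) < top"
      by (rule hausdorff_outer_lipschitz_image_finite[OF subspace_S dim_S _ _ lipschitz_on_subset[OF r(3)]])
        (auto intro: bounded_subset[OF bounded_ball])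
  qed
  ultimately show ?thesis by (rule that)
qed

lemma hausdorff_outer_finite:
  assumes "compact M"
  shows "hausdorff_outer k M < top"
proof -
  have "\<forall>p\<in>M. \<exists>W. open W \<and> p \<in> W \<and> hausdorff_outer k (M \<inter> W) < top"
    using hausdorff_outer_locally_finite by metis
  then obtain W where W: "\<And>p. p \<in> M \<Longrightarrow> open (W p) \<and> p \<in> W p \<and> hausdorff_outer k (M \<inter> W p) < top"
    by metis
  have "M \<subseteq> (\<Union>p\<in>M. W p)" using W by blast
  then obtain C where C: "C \<subseteq> M" "finite C" "M \<subseteq> (\<Union>p\<in>C. W p)"
    using compactE_image[OF assms, of M W] W by metis
  have "hausdorff_outer k (\<Union>p\<in>C. M \<inter> W p) < top"
    using C W by (intro hausdorff.finite_UN_less_top) auto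
  moreover have "(\<Union>p\<in>C. M \<inter> W p) = M" using C(3) by blast
  ultimately show ?thesis by simp
qed

text \<open>Here the chart is used in the opposite direction: \<open>\<phi>\<close> is Lipschitz
  near \<open>p\<close> and maps \<open>M\<close> near \<open>p\<close> onto a set containing a ball
  of \<open>S\<close>.\<close>

lemma hausdorff_outer_positive:
  assumes "p \<in> M"
  shows "0 < hausdorff_outer k M"
proof -
  obtain W V \<phi> \<psi> S where ch: "submanifold_chart k M W V \<phi> \<psi> S" and p: "p \<in> W"
    using C2_submanifold_chart[OF C2 assms] by blast
  interpret submanifold_chart k M W V \<phi> \<psi> S by (rule ch)
  obtain r L where r: "0 < r" "ball p r \<subseteq> W" "L-lipschitz_on (ball p r) \<phi>"
    using C1_on_locally_lipschitz[OF C2_on_imp_C1_on[OF C2_\<phi>] open_W p] by blast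
  have "open (V \<inter> \<psi> -` ball p r)"
    using C1_on_continuous[OF C2_on_imp_C1_on[OF C2_\<psi>]] open_V
    by (intro continuous_open_preimage) auto
  moreover have "\<phi> p \<in> V \<inter> \<psi> -` ball p r" using p r(1) by (simp add: \<phi>_V \<psi>_\<phi>)
  ultimately obtain s where s: "0 < s" "ball (\<phi> p) s \<subseteq> V \<inter> \<psi> -` ball p r"
    using open_contains_ball by metis
  have "0 < hausdorff_outer k (M \<inter> ball p r)"
  proof (rule hausdorff_outer_pos[OF subspace_S dim_S \<phi>_S[OF assms p] s(1) _ lipschitz_on_subset[OF r(3)]])
    show "S \<inter> ball (\<phi> p) s \<subseteq> \<phi> ` (M \<inter> ball p r)"
    proof
      fix y assume y: "y \<in> S \<inter> ball (\<phi> p) s"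
      then have "y \<in> V" "\<psi> y \<in> ball p r" using s(2) by auto
      then have "y = \<phi> (\<psi> y)" "\<psi> y \<in> M \<inter> ball p r" using y by (simp_all add: \<phi>_\<psi> \<psi>_M)
      then show "y \<in> \<phi> ` (M \<inter> ball p r)" by (rule image_eqI)
    qed
  qed simp
  also have "\<dots> \<le> hausdorff_outer k M" by (rule hausdorff.mono) simp
  finally show ?thesis .
qed

lemma set_integrable_continuous:
  fixes g :: "'a \<Rightarrow> real"
  assumes M: "compact M" and g: "continuous_on M g"
  shows "set_integrable (hausdorff k) M g"
proof -
  have MB: "M \<in> sets borel" using M by (simp add: borel_closed compact_imp_closed)
  obtain B where B: "\<And>x. x \<in> M \<Longrightarrow> norm (g x) \<le> B"
    using compact_imp_bounded[OF compact_continuous_image[OF g M]] unfolding bounded_iff by blast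
  \<comment> \<open>The inner indicator makes the integrand Borel on the whole space, since
    \<open>g\<close> is controlled only on \<open>M\<close>; the outer one is the form of the
    integrability criterion. They collapse afterwards.\<close>
  have "integrable (hausdorff k) (\<lambda>x. indicator M x *\<^sub>R (indicator M x *\<^sub>R g x))"
  proof (rule integrableI_bounded_set_indicator)
    show "M \<in> sets (hausdorff k)" using MB by simp
    show "(\<lambda>x. indicator M x *\<^sub>R g x) \<in> borel_measurable (hausdorff k)"
      using borel_measurable_continuous_on_indicator[OF MB g]
      by (simp add: measurable_cong_sets[OF sets_hausdorff refl])
    show "emeasure (hausdorff k) M < \<infinity>"
      using hausdorff_outer_finite[OF M] by (simp add: emeasure_hausdorff[OF MB])
    show "AE x in hausdorff k. x \<in> M \<longrightarrow> norm (indicator M x *\<^sub>R g x) \<le> B" using B by simp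
  qed
  moreover have "indicator M x *\<^sub>R (indicator M x *\<^sub>R g x) = indicator M x *\<^sub>R g x" for x
    by (simp add: indicator_def)
  ultimately show ?thesis by (simp only: set_integrable_def)
qed

end

lemma set_lebesgue_integral_sum:
  fixes f :: "'i \<Rightarrow> 'a \<Rightarrow> real"
  assumes "\<And>i. i \<in> I \<Longrightarrow> set_integrable N A (f i)"
  shows "(LINT x:A|N. (\<Sum>i\<in>I. f i x)) = (\<Sum>i\<in>I. LINT x:A|N. f i x)"
  using assms unfolding set_lebesgue_integral_def set_integrable_def
  by (simp add: sum_distrib_left Bochner_Integration.integral_sum)

section \<open>Stationarity and the averaged stability inequality\<close>

context sphere_submanifold
begin

text \<open>At \<open>p\<close> both sides are the multiple \<open>- k * R powi (- k - 2)\<close> of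
  the normal vector \<open>p\<close>. Without this fact, failure of \<open>f_stable\<close> could
  merely mean failure of stationarity.\<close>

lemma f_stationary_minimal:
  assumes min: "\<And>p. p \<in> M \<Longrightarrow> mean_curvature (sphere 0 R) M p = 0"
  shows "f_stationary (\<lambda>x. norm x powi (- int k)) U M"
  unfolding f_stationary_def
proof
  fix p assume "p \<in> M \<inter> U"
  then have p: "p \<in> M" by simp
  have p0: "p \<noteq> 0" using norm_M[OF p] R by auto
  have "orth_proj (NU p) p = p"
    using tangent_orthogonal by (intro orth_proj_id subspace_NU) (simp add: normal_space_UNIV inner_commute)
  then have "orth_proj (NU p) (grad (\<lambda>x. norm x powi (- int k)) p)
      = (of_int (- int k) * R powi (- int k - 2)) *\<^sub>R p"
    by (simp add: grad_norm_powi[OF p0] norm_M[OF p] linear_neg[OF linear_orth_proj[OF subspace_NU]]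
        linear_scale[OF linear_orth_proj[OF subspace_NU]])
  also have "R powi (- int k - 2) = R powi (- int k) / R\<^sup>2"
    using R by (subst power_int_diff) auto
  finally show "(norm p powi (- int k)) *\<^sub>R mean_curvature UNIV M p
      = orth_proj (NU p) (grad (\<lambda>x. norm x powi (- int k)) p)"
    by (simp add: mean_curvature_UNIV[OF p min[OF p]] norm_M[OF p])
qed

lemma normal_variation_X:
  assumes "compact M" "0 \<notin> M"
  shows "normal_variation (UNIV - {0}) M (X v)"
proof -
  have sub: "closure {p \<in> M. X v p \<noteq> 0} \<subseteq> M"
    using assms by (intro closure_minimal compact_imp_closed) auto
  have "bounded {p \<in> M. X v p \<noteq> 0}"
    by (rule bounded_subset[OF compact_imp_bounded[OF assms(1)]]) auto
  then have "compact (closure {p \<in> M. X v p \<noteq> 0})" by simp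
  moreover have "\<forall>p\<in>M. X v p \<in> NU p" by (simp add: normal_space_UNIV X_inner_T)
  moreover have "closure {p \<in> M. X v p \<noteq> 0} \<subseteq> UNIV - {0}" using sub assms(2) by blast
  ultimately show ?thesis unfolding normal_variation_def using C1_along_X by blast
qed

lemma f_unstable:
  assumes compact: "compact M" and ne: "M \<noteq> {}" and k: "1 \<le> k" "k + 2 \<le> DIM('a)"
    and min: "\<And>p. p \<in> M \<Longrightarrow> mean_curvature (sphere 0 R) M p = 0"
  shows "\<not> f_stable k (\<lambda>x. norm x powi (- int k)) (UNIV - {0}) M"
proof
  assume stable: "f_stable k (\<lambda>x. norm x powi (- int k)) (UNIV - {0}) M"
  let ?f = "\<lambda>x::'a. norm x powi (- int k)"
  let ?I = "\<lambda>g. LINT p:M|hausdorff k. g p :: real"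
  have MB: "M \<in> sets borel" using compact by (simp add: borel_closed compact_imp_closed)
  then have MH: "M \<in> sets (hausdorff k)" by simp
  have zero: "0 \<notin> M" using norm_M[of 0] R by auto
  \<comment> \<open>On \<open>M\<close> the norm is \<open>R\<close>, so \<open>f\<close> has the
    constant value \<open>a\<close>, and the Hessian on vectors orthogonal to \<open>p\<close> is
    \<open>- b\<close> times the squared norm.\<close>
  define a where "a = R powi (- int k)"
  define b where "b = real k * R powi (- int k - 2)"
  have b: "0 < b" using k R by (simp add: b_def)
  have intG: "set_integrable (hausdorff k) M (G d v)" for d v
    by (rule set_integrable_continuous[OF compact continuous_on_G])
  have intX: "set_integrable (hausdorff k) M (\<lambda>p. (norm (X v p))\<^sup>2)" for v
    by (intro set_integrable_continuous[OF compact] continuous_intros continuous_on_X)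
  have ineq: "a * (\<Sum>d\<in>Basis. ?I (G d v)) \<le> a * (\<Sum>d\<in>Basis. ?I (G v d)) - b * ?I (\<lambda>p. (norm (X v p))\<^sup>2)" for v
  proof -
    have intGs: "set_integrable (hausdorff k) M (\<lambda>p. \<Sum>d\<in>Basis. G (s d) (t d) p)" for s t :: "'a \<Rightarrow> 'a"
      by (intro set_integrable_continuous[OF compact] continuous_intros continuous_on_G)
    have "(LINT p:M|hausdorff k.
           ?f p * ((\<Sum>u\<in>orthonormal_frame M p. \<Sum>w\<in>orthonormal_frame M p.
                     (second_fundamental_form UNIV M p u w \<bullet> X v p)\<^sup>2)
                  + (mean_curvature UNIV M p \<bullet> X v p)\<^sup>2))
        \<le> (LINT p:M|hausdorff k.
             ?f p * (\<Sum>u\<in>orthonormal_frame M p.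
                      (norm (orth_proj (normal_space UNIV M p) (D_along M (X v) p u)))\<^sup>2)
             + hess ?f p (X v p) (X v p))"
      using stable normal_variation_X[OF compact zero] unfolding f_stable_def by blast
    also have "(LINT p:M|hausdorff k.
           ?f p * ((\<Sum>u\<in>orthonormal_frame M p. \<Sum>w\<in>orthonormal_frame M p.
                     (second_fundamental_form UNIV M p u w \<bullet> X v p)\<^sup>2)
                  + (mean_curvature UNIV M p \<bullet> X v p)\<^sup>2)) = ?I (\<lambda>p. a * (\<Sum>d\<in>Basis. G d v p))"
      by (intro set_lebesgue_integral_cong[OF MH] allI impI)
        (simp add: curvature_term[OF _ min] norm_M a_def)
    also have "\<dots> = a * (\<Sum>d\<in>Basis. ?I (G d v))"
      by (simp add: set_lebesgue_integral_sum intG)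
    also have "(LINT p:M|hausdorff k.
             ?f p * (\<Sum>u\<in>orthonormal_frame M p.
                      (norm (orth_proj (normal_space UNIV M p) (D_along M (X v) p u)))\<^sup>2)
             + hess ?f p (X v p) (X v p))
        = ?I (\<lambda>p. a * (\<Sum>d\<in>Basis. G v d p) - b * (norm (X v p))\<^sup>2)"
    proof (intro set_lebesgue_integral_cong[OF MH] allI impI)
      fix p assume p: "p \<in> M"
      have "p \<noteq> 0" using p zero by auto
      then show "?f p * (\<Sum>u\<in>orthonormal_frame M p.
            (norm (orth_proj (normal_space UNIV M p) (D_along M (X v) p u)))\<^sup>2) + hess ?f p (X v p) (X v p)
          = a * (\<Sum>d\<in>Basis. G v d p) - b * (norm (X v p))\<^sup>2"
        by (simp add: gradient_term[OF p] hess_norm_powi X_inner_p[OF p] norm_M[OF p] a_def b_def)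
    qed
    also have "\<dots> = a * (\<Sum>d\<in>Basis. ?I (G v d)) - b * ?I (\<lambda>p. (norm (X v p))\<^sup>2)"
      using intGs[of "\<lambda>_. v" "\<lambda>d. d"]
      by (subst set_integral_diff) (simp_all add: intX set_lebesgue_integral_sum intG)
    finally show ?thesis .
  qed
  have "(\<Sum>v\<in>Basis. a * (\<Sum>d\<in>Basis. ?I (G d v)))
      \<le> (\<Sum>v\<in>Basis. a * (\<Sum>d\<in>Basis. ?I (G v d)) - b * ?I (\<lambda>p. (norm (X v p))\<^sup>2))"
    by (rule sum_mono) (rule ineq)
  also have "\<dots> = a * (\<Sum>v\<in>Basis. \<Sum>d\<in>Basis. ?I (G v d)) - b * (\<Sum>v\<in>Basis. ?I (\<lambda>p. (norm (X v p))\<^sup>2))"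
    by (simp add: sum_subtractf sum_distrib_left)
  \<comment> \<open>After this exchange the gradient and curvature sums agree, and as finite real
    numbers they cancel.\<close>
  also have "(\<Sum>v\<in>Basis. \<Sum>d\<in>Basis. ?I (G v d)) = (\<Sum>v\<in>Basis. \<Sum>d\<in>Basis. ?I (G d v))"
    by (rule sum.swap)
  finally have "b * (\<Sum>v\<in>Basis. ?I (\<lambda>p. (norm (X v p))\<^sup>2)) \<le> 0"
    by (simp add: sum_distrib_left)
  moreover have "(\<Sum>v\<in>Basis. ?I (\<lambda>p. (norm (X v p))\<^sup>2)) = measure (hausdorff k) M * (real DIM('a) - real k - 1)"
  proof -
    have "(\<Sum>v\<in>Basis. ?I (\<lambda>p. (norm (X v p))\<^sup>2)) = ?I (\<lambda>p. \<Sum>v\<in>Basis. (norm (X v p))\<^sup>2)"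
      by (rule set_lebesgue_integral_sum[symmetric]) (rule intX)
    also have "\<dots> = ?I (\<lambda>p. real DIM('a) - real k - 1)"
      by (intro set_lebesgue_integral_cong[OF MH] allI impI) (rule sum_norm_X)
    also have "\<dots> = measure (hausdorff k) M * (real DIM('a) - real k - 1)"
      using hausdorff_outer_finite[OF compact]
      by (subst set_integral_const) (simp_all add: MB emeasure_hausdorff less_top)
    finally show ?thesis .
  qed
  moreover have "0 < measure (hausdorff k) M"
    using hausdorff_outer_finite[OF compact] hausdorff_outer_positive ne
    by (auto simp: measure_def emeasure_hausdorff[OF MB] enn2real_positive_iff)
  \<comment> \<open>\<open>b\<close>, the measure of \<open>M\<close> and \<open>n - k - 1\<close>
    are all positive, the last because \<open>k + 2\<close> is at most the dimension.\<close>
  ultimately show False using b k by (simp add: mult_le_0_iff not_less)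
qed

end

theorem theorem1p5:
  fixes M :: "(real ^ 'n) set" and k :: nat and R :: real
  assumes "1 \<le> k" and "k + 2 \<le> CARD('n)" and "R > 0"
    and "minimal_submanifold k (sphere 0 R) M"
    and "(UNIV - {0}) \<inter> M \<noteq> {}"
    and "(UNIV - {0}) \<inter> (closure M - M) = {}"
  shows "f_stationary (\<lambda>x. norm x powi (- int k)) (UNIV - {0}) M \<and>
         \<not> f_stable k (\<lambda>x. norm x powi (- int k)) (UNIV - {0}) M"
proof -
  have M: "C2_submanifold k M" "M \<subseteq> sphere 0 R" "\<And>p. p \<in> M \<Longrightarrow> mean_curvature (sphere 0 R) M p = 0"
    using assms(4) by (auto simp: minimal_submanifold_def)
  interpret sphere_submanifold k M R
    using M assms(3) by unfold_locales
  \<comment> \<open>Limit points of \<open>M\<close> stay on the sphere, hence away from 0, and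
    there the hypothesis on \<open>closure M - M\<close> puts them into \<open>M\<close>.\<close>
  have "closure M \<subseteq> sphere 0 R" using M(2) by (rule closure_minimal) simp
  then have "0 \<notin> closure M" using assms(3) by auto
  then have "x \<in> M" if "x \<in> closure M" for x
    using assms(6) that by (cases "x = 0") (auto simp: disjoint_iff)
  then have "closure M \<subseteq> M" by (rule subsetI)
  then have "closed M" by (metis closure_subset_eq)
  moreover have "bounded M" using bounded_sphere M(2) by (rule bounded_subset)
  ultimately have "compact M" by (simp add: compact_eq_bounded_closed)
  moreover have "M \<noteq> {}" using assms(5) by blast
  moreover have "k + 2 \<le> DIM(real ^ 'n)" using assms(2) by simp
  ultimately show ?thesis
    using f_stationary_minimal[OF M(3)] f_unstable[OF _ _ assms(1) _ M(3)] by (intro conjI)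
qed

end
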